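(* Let $\hat J\in[0,+\infty)$. For each positive integer $N$ let $\mu_N$ be the Gibbs measure of the one-dimensional periodic Ising model on $\{-1,+1\}^N$ with coupling constant $\hat J$, let $(Y_k)_{k\ge1}$ be the Wolff dynamics on $\{-1,+1\}^N$ with coupling constant $\hat J$, and let $\mathbb P_{\mu_N}$ be the law of this chain started from $Y_1\sim\mu_N$. For $M\ge1$ let $\mathbb K$ be the $N\times N$ sample covariance matrix $$\mathbb K=\frac1{MN}\sum_{k=1}^MY_kY_k^T.$$ Then, as $N,M\to+\infty$ with $N=o(\sqrt M)$ (i.e. $N/\sqrt M\to0$ as $M\to+\infty$), $$\lim_{N,M\to+\infty}E^{\mathbb P_{\mu_N}}\big[\|\mathbb K\|_1^2\big]=0,$$ which implies $$\lim_{N,M\to+\infty}E^{\mathbb P_{\mu_N}}[\rho(\mathbb K)]=0,$$ where $\|\mathbb K\|_1=\max_{1\le i\le N}\sum_{j=1}^N|\mathbb K_{ij}|$ and $\rho(\mathbb K)$ is the spectral radius of $\mathbb K$.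
   Context: Indices in $[N]=\{1,\dots,N\}$ are cyclic ($N+1\equiv1$). The Gibbs measure is $\mu_N(\sigma)=Z_N^{-1}\exp\big(\hat J\sum_{i=1}^N\sigma_i\sigma_{i+1}\big)$ on $\Omega=\{-1,+1\}^N$, with $Z_N$ the normalizing constant. $E^{\mathbb P_{\mu_N}}$ is expectation under $\mathbb P_{\mu_N}$. $G=([N],\mathcal G)$ is the undirected cycle with the $N$ edges $\{i,i+1\}$, $i=1,\dots,N$ (counted with multiplicity if $N=2$). Wolff dynamics: one step from $\sigma\in\Omega$ is as follows. Choose a site $i_0\in[N]$ uniformly at random and start the cluster with $i_0$. Repeatedly, for each site $i$ in the cluster and each edge joining $i$ to a neighbour $j$ with $\sigma_j=\sigma_i$ such that this edge has not been considered before, add $j$ to the cluster with probability $1-e^{-\hat J(1+\sigma_i\sigma_j)}=1-e^{-2\hat J}$, independently over edges. When no edge remains to be considered, flip all spins of the cluster (with probability 1). Equivalently: declare each edge with aligned endpoint spins open independently with probability $1-e^{-2\hat J}$ (all other edges are closed), and flip the open-connected component of $i_0$. In the paper $\mathbb K=\frac1M\mathbb X\mathbb X^T$, where $\mathbb X=(X_1,\dots,X_M)$ is the $N\times M$ matrix with columns $X_k=Y_k/\sqrt N$; this is the matrix displayed in the claim. The double limit means: along any choice $N=N(M)\to+\infty$ as $M\to+\infty$ with $N/\sqrt M\to0$. *)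

theory Defs
  imports "HOL-Probability.Probability" "Jordan_Normal_Form.Spectral_Radius"
begin

text \<open>
  The sites \<open>1, \<dots>, N\<close> are represented by \<open>0, \<dots>, N - 1\<close>, and a spin configuration is an
  extensional function on \<open>{..<N}\<close>. Edge \<open>e\<close> of the cycle joins \<open>e\<close> and \<open>cyc N e\<close>, so the \<open>N\<close>
  edges are distinguishable also for \<open>N = 2\<close>.
\<close>

definition configs :: "nat \<Rightarrow> (nat \<Rightarrow> int) set" where
  "configs N = ({..<N} \<rightarrow>\<^sub>E {-1, 1})"

definition cyc :: "nat \<Rightarrow> nat \<Rightarrow> nat" where
  "cyc N i = Suc i mod N"

definition gibbs_weight :: "real \<Rightarrow> nat \<Rightarrow> (nat \<Rightarrow> int) \<Rightarrow> real" where
  "gibbs_weight J N \<sigma> = exp (J * (\<Sum>i<N. real_of_int (\<sigma> i * \<sigma> (cyc N i))))"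

definition partition_function :: "real \<Rightarrow> nat \<Rightarrow> real" where
  "partition_function J N = (\<Sum>\<sigma>\<in>configs N. gibbs_weight J N \<sigma>)"

definition gibbs :: "real \<Rightarrow> nat \<Rightarrow> (nat \<Rightarrow> int) pmf" where
  "gibbs J N = embed_pmf (\<lambda>\<sigma>. if \<sigma> \<in> configs N
     then gibbs_weight J N \<sigma> / partition_function J N else 0)"

lemma finite_configs: "finite (configs N)"
  by (auto simp: configs_def intro!: finite_PiE)

lemma configs_nonempty: "configs N \<noteq> {}"
  by (auto simp: configs_def PiE_eq_empty_iff)

lemma partition_function_pos: "partition_function J N > 0"
  unfolding partition_function_def gibbs_weight_def
  by (intro sum_pos finite_configs configs_nonempty) simp

lemma pmf_gibbs:
  "pmf (gibbs J N) \<sigma> =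
     (if \<sigma> \<in> configs N then gibbs_weight J N \<sigma> / partition_function J N else 0)"
  unfolding gibbs_def
proof (rule pmf_embed_pmf)
  fix \<sigma>
  show "0 \<le> (if \<sigma> \<in> configs N then gibbs_weight J N \<sigma> / partition_function J N else 0)"
    using partition_function_pos[of J N] by (simp add: gibbs_weight_def)
next
  let ?f = "\<lambda>\<sigma>. if \<sigma> \<in> configs N then gibbs_weight J N \<sigma> / partition_function J N else 0"
  have nn: "0 \<le> ?f \<sigma>" for \<sigma>
    using partition_function_pos[of J N] by (simp add: gibbs_weight_def)
  have "(\<integral>\<^sup>+ \<sigma>. ennreal (?f \<sigma>) \<partial>count_space UNIV)
      = (\<Sum>\<sigma>\<in>configs N. ennreal (?f \<sigma>))"
    by (rule nn_integral_count_space') (auto simp: finite_configs)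
  also have "\<dots> = ennreal (\<Sum>\<sigma>\<in>configs N. ?f \<sigma>)"
    using nn by (rule sum_ennreal)
  also have "(\<Sum>\<sigma>\<in>configs N. ?f \<sigma>) = 1"
    using partition_function_pos[of J N]
    by (simp add: sum_divide_distrib[symmetric] partition_function_def)
  finally show "(\<integral>\<^sup>+ \<sigma>. ennreal (?f \<sigma>) \<partial>count_space UNIV) = 1"
    by simp
qed

definition edge_open_prob :: "real \<Rightarrow> nat \<Rightarrow> (nat \<Rightarrow> int) \<Rightarrow> nat \<Rightarrow> real" where
  "edge_open_prob J N \<sigma> e = (if \<sigma> e = \<sigma> (cyc N e) then 1 - exp (- 2 * J) else 0)"

text \<open>
  The cluster is taken in its percolation form: the component of the initial site in the graph of
  open edges. \<open>bernoulli_pmf\<close> expects a parameter in \<open>{0..1}\<close>, which holds here for \<open>J \<ge> 0\<close>.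
\<close>

definition open_edges :: "real \<Rightarrow> nat \<Rightarrow> (nat \<Rightarrow> int) \<Rightarrow> (nat \<Rightarrow> bool) pmf" where
  "open_edges J N \<sigma> = Pi_pmf {..<N} False (\<lambda>e. bernoulli_pmf (edge_open_prob J N \<sigma> e))"

definition cluster :: "nat \<Rightarrow> (nat \<Rightarrow> bool) \<Rightarrow> nat \<Rightarrow> nat set" where
  "cluster N \<eta> i =
     {j. (i, j) \<in> {(a, b). \<exists>e<N. \<eta> e \<and> {a, b} = {e, cyc N e}}\<^sup>*}"

definition flip :: "nat set \<Rightarrow> (nat \<Rightarrow> int) \<Rightarrow> nat \<Rightarrow> int" where
  "flip C \<sigma> i = (if i \<in> C then - \<sigma> i else \<sigma> i)"

definition wolff_step :: "real \<Rightarrow> nat \<Rightarrow> (nat \<Rightarrow> int) \<Rightarrow> (nat \<Rightarrow> int) pmf" where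
  "wolff_step J N \<sigma> =
     bind_pmf (pmf_of_set {..<N}) (\<lambda>i.
       map_pmf (\<lambda>\<eta>. flip (cluster N \<eta> i) \<sigma>) (open_edges J N \<sigma>))"

text \<open>
  The library's Ionescu-Tulcea construction, for the kernels that sample the state at time
  \<open>0\<close> from \<open>p\<close> and the state at time \<open>n + 1\<close> from \<open>K\<close> applied to the state at time \<open>n\<close>.
\<close>

definition chain_kernel :: "'s pmf \<Rightarrow> ('s \<Rightarrow> 's pmf) \<Rightarrow> nat \<Rightarrow> (nat \<Rightarrow> 's) \<Rightarrow> 's measure" where
  "chain_kernel p K n x =
     measure_pmf (case n of 0 \<Rightarrow> p | Suc k \<Rightarrow> K (x k))"

definition chain_law :: "'s pmf \<Rightarrow> ('s \<Rightarrow> 's pmf) \<Rightarrow> (nat \<Rightarrow> 's) measure" where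
  "chain_law p K =
     projective_family.lim UNIV
       (Ionescu_Tulcea.CI (chain_kernel p K) (\<lambda>_. count_space UNIV)) (\<lambda>_. count_space UNIV)"

lemma Ionescu_Tulcea_chain:
  "Ionescu_Tulcea (chain_kernel p K) (\<lambda>_. count_space UNIV)"
proof (rule Ionescu_Tulcea.intro)
  fix n
  show "chain_kernel p K n
    \<in> measurable (PiM {0..<n} (\<lambda>_. count_space UNIV)) (subprob_algebra (count_space UNIV))"
  proof (cases n)
    case 0
    then show ?thesis
      by (auto simp: chain_kernel_def[abs_def] measure_pmf_in_subprob_algebra)
  next
    case (Suc k)
    have 1: "(\<lambda>x. x k) \<in> measurable (PiM {0..<n} (\<lambda>_. count_space UNIV)) (count_space UNIV)"
      using measurable_component_singleton[of k "{0..<n}" "\<lambda>_. count_space UNIV"] Suc by simp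
    have 2: "(\<lambda>s. measure_pmf (K s)) \<in> measurable (count_space UNIV) (subprob_algebra (count_space UNIV))"
      by (auto simp: measure_pmf_in_subprob_algebra)
    show ?thesis
      using measurable_compose[OF 1 2] Suc by (simp add: chain_kernel_def[abs_def])
  qed
next
  fix n and x :: "nat \<Rightarrow> 'a"
  show "prob_space (chain_kernel p K n x)"
    unfolding chain_kernel_def by (rule prob_space_measure_pmf)
qed

lemma sets_chain_law: "sets (chain_law p K) = sets (PiM UNIV (\<lambda>_. count_space UNIV))"
  and space_chain_law: "space (chain_law p K) = UNIV"
  and prob_space_chain_law: "prob_space (chain_law p K)"
  and emeasure_chain_law_cylinder:
    "emeasure (chain_law p K) {\<omega>. \<forall>k\<le>n. \<omega> k = x k} =
       ennreal (pmf p (x 0) * (\<Prod>k<n. pmf (K (x k)) (x (Suc k))))"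
proof -
  let ?M = "\<lambda>_::nat. count_space (UNIV::'a set)"
  interpret IT: Ionescu_Tulcea "chain_kernel p K" ?M
    by (rule Ionescu_Tulcea_chain)
  have law: "chain_law p K = IT.PF.lim"
    by (simp add: chain_law_def)
  show "sets (chain_law p K) = sets (PiM UNIV ?M)"
    by (simp add: law)
  show "space (chain_law p K) = UNIV"
    by (simp add: law space_PiM)
  define u where "u = (\<lambda>x::nat. undefined :: 'a)"
  define r where "r m = restrict x {0..<m}" for m
  have u: "u \<in> space (PiM {0..<0} ?M)"
    by (simp add: u_def space_PiM)
  have r_eq: "{r m} = (\<Pi>\<^sub>E i\<in>{0..<m}. {x i})" for m
  proof -
    have "(\<Pi>\<^sub>E i\<in>{0..<m}. {x i}) = (\<Pi>\<^sub>E i\<in>{0..<m}. {r m i})"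
      by (intro PiE_cong) (simp add: r_def)
    also have "\<dots> = {r m}"
      unfolding r_def by (rule PiE_singleton) (rule restrict_extensional)
    finally show ?thesis by simp
  qed
  have r_sets[measurable]: "{r m} \<in> sets (PiM {0..<m} ?M)" for m
    unfolding r_eq by (intro sets_PiM_I_finite) auto
  define w where "w m = (\<Prod>k<m. case k of 0 \<Rightarrow> pmf p (x 0) | Suc j \<Rightarrow> pmf (K (x j)) (x k))" for m
  have w_nonneg: "w m \<ge> 0" for m
    unfolding w_def by (intro prod_nonneg) (auto split: nat.split)
  have C: "emeasure (IT.C 0 m u) {r m} = ennreal (w m)" for m
  proof (induction m)
    case 0
    have "r 0 = u" by (auto simp: r_def u_def)
    then show ?case using r_sets[of 0] by (simp add: w_def)
  next
    case (Suc m)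
    let ?a = "case m of 0 \<Rightarrow> pmf p (x 0) | Suc j \<Rightarrow> pmf (K (x j)) (x m)"
    have a0: "?a \<ge> 0" by (auto split: nat.split)
    have sp: "space (IT.C 0 m u) = space (PiM {0..<m} ?M)"
      using IT.space_C[OF u, of m] by simp
    have st: "sets (IT.C 0 m u) = sets (PiM {0..<m} ?M)"
      using IT.sets_C[OF u, of m] by simp
    have eP: "emeasure (IT.eP m \<omega>) {r (Suc m)} = ennreal ?a * indicator {r m} \<omega>"
      if \<omega>: "\<omega> \<in> space (PiM {0..<m} ?M)" for \<omega>
    proof -
      have ext: "\<omega> \<in> extensional {0..<m}"
        using \<omega> by (auto simp: space_PiM PiE_def)
      have eq: "fun_upd \<omega> m y = r (Suc m) \<longleftrightarrow> \<omega> = r m \<and> y = x m" for y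
      proof
        assume h: "fun_upd \<omega> m y = r (Suc m)"
        have "\<omega> i = r m i" for i
          using fun_cong[OF h, of i] ext
          by (cases "i < m"; cases "i = m") (simp_all add: r_def extensional_def)
        moreover have "y = x m" using fun_cong[OF h, of m] by (simp add: r_def)
        ultimately show "\<omega> = r m \<and> y = x m" by auto
      qed (auto simp: r_def fun_eq_iff)
      have "emeasure (IT.eP m \<omega>) {r (Suc m)}
          = emeasure (chain_kernel p K m \<omega>) ((\<lambda>y. fun_upd \<omega> m y) -` {r (Suc m)})"
        by (subst IT.emeasure_eP[OF \<omega> r_sets]) simp
      also have "(\<lambda>y. fun_upd \<omega> m y) -` {r (Suc m)} = (if \<omega> = r m then {x m} else {})"
        unfolding vimage_def singleton_iff eq by auto
      also have "emeasure (chain_kernel p K m \<omega>) \<dots> = ennreal ?a * indicator {r m} \<omega>"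
        by (auto simp: chain_kernel_def emeasure_pmf_single r_def split: nat.split)
      finally show ?thesis .
    qed
    have "emeasure (IT.C 0 (Suc m) u) {r (Suc m)}
        = (\<integral>\<^sup>+\<omega>. emeasure (IT.eP m \<omega>) {r (Suc m)} \<partial>IT.C 0 m u)"
      unfolding IT.C.simps using sp
      by (subst emeasure_bind[where N="PiM {0..<Suc m} ?M"])
         (auto simp: measurable_cong_sets[OF st refl] intro: IT.measurable_eP)
    also have "\<dots> = (\<integral>\<^sup>+\<omega>. ennreal ?a * indicator {r m} \<omega> \<partial>IT.C 0 m u)"
      using eP by (intro nn_integral_cong) (simp add: sp)
    also have "\<dots> = ennreal ?a * emeasure (IT.C 0 m u) {r m}"
      using r_sets[of m] by (intro nn_integral_cmult_indicator) (simp add: st)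
    also have "\<dots> = ennreal (w (Suc m))"
      using Suc a0 w_nonneg[of m]
      by (simp add: w_def ennreal_mult'[symmetric] mult.commute split: nat.split)
    finally show ?case .
  qed
  have lim: "emeasure IT.PF.lim (prod_emb UNIV ?M {0..<m} X) = emeasure (IT.C 0 m u) X"
    if X: "X \<in> sets (PiM {0..<m} ?M)" for m X
  proof -
    have "prod_emb {0..<m} ?M {0..<m} X = X"
      using sets.sets_into_space[OF X] by (intro prod_emb_id) (simp add: space_PiM)
    then show ?thesis
      using X by (simp add: IT.lim IT.emeasure_CI[of _ m] u_def)
  qed
  have "{\<omega>. \<forall>k\<le>n. \<omega> k = x k} = prod_emb UNIV ?M {0..<Suc n} {r (Suc n)}"
  proof -
    have "restrict \<omega> {0..<Suc n} = r (Suc n) \<longleftrightarrow> (\<forall>k\<le>n. \<omega> k = x k)" for \<omega>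
      unfolding r_def by (auto simp: fun_eq_iff restrict_def less_Suc_eq_le split: if_splits)
    then show ?thesis
      by (simp add: prod_emb_def space_PiM vimage_def)
  qed
  then have "emeasure (chain_law p K) {\<omega>. \<forall>k\<le>n. \<omega> k = x k} = ennreal (w (Suc n))"
    by (simp add: law lim C del: IT.C.simps)
  also have "w (Suc n) = pmf p (x 0) * (\<Prod>k<n. pmf (K (x k)) (x (Suc k)))"
    unfolding w_def by (subst prod.lessThan_Suc_shift) simp
  finally show "emeasure (chain_law p K) {\<omega>. \<forall>k\<le>n. \<omega> k = x k} =
       ennreal (pmf p (x 0) * (\<Prod>k<n. pmf (K (x k)) (x (Suc k))))" .
  have "emeasure IT.PF.lim UNIV = 1"
  proof -
    have "UNIV = prod_emb UNIV ?M {0..<0} {u}"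
      by (auto simp: prod_emb_def u_def fun_eq_iff space_PiM)
    moreover have "{u} \<in> sets (PiM {0..<0} ?M)"
      using r_sets[of 0] by (simp add: r_def u_def restrict_def)
    ultimately show ?thesis using lim[of "{u}" 0] u by simp
  qed
  then show "prob_space (chain_law p K)"
    by (intro prob_spaceI) (simp add: law space_PiM)
qed

text \<open>
  The coordinate \<open>\<omega> k\<close> of a trajectory is \<open>Y\<close> with index \<open>k + 1\<close>; in particular \<open>\<omega> 0\<close> has law
  \<open>gibbs J N\<close>.
\<close>

definition wolff_law :: "real \<Rightarrow> nat \<Rightarrow> (nat \<Rightarrow> nat \<Rightarrow> int) measure" where
  "wolff_law J N = chain_law (gibbs J N) (wolff_step J N)"

definition sample_cov :: "nat \<Rightarrow> nat \<Rightarrow> (nat \<Rightarrow> nat \<Rightarrow> int) \<Rightarrow> real mat" where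
  "sample_cov N M \<omega> =
     mat N N (\<lambda>(i, j). (\<Sum>k<M. real_of_int (\<omega> k i * \<omega> k j)) / (real M * real N))"

definition row_sum_norm :: "real mat \<Rightarrow> real" where
  "row_sum_norm A = Max ((\<lambda>i. \<Sum>j<dim_col A. \<bar>A $$ (i, j)\<bar>) ` {..<dim_row A})"

text \<open>
  Every function of the sample covariance matrix is a random variable. It is almost surely
  bounded, as the chain almost surely stays in the finite set \<open>configs N\<close>; hence its Bochner
  integral is a genuine expectation.
\<close>

lemma measurable_sample_cov:
  fixes f :: "real mat \<Rightarrow> real"
  shows "(\<lambda>\<omega>. f (sample_cov N M \<omega>)) \<in> borel_measurable (wolff_law J N)"
proof -
  define g where "g = (\<lambda>\<omega>::nat \<Rightarrow> nat \<Rightarrow> int. map (\<lambda>k. map (\<omega> k) [0..<N]) [0..<M])"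
  define h where "h = (\<lambda>l::int list list. sample_cov N M (\<lambda>k i. l ! k ! i))"
  have sc: "sample_cov N M \<omega> = h (g \<omega>)" for \<omega>
    by (auto simp: h_def g_def sample_cov_def intro!: eq_matI sum.cong)
  have "g \<in> measurable (wolff_law J N) (count_space UNIV)"
  proof (subst measurable_count_space_eq2_countable, safe)
    fix l :: "int list list"
    have comp: "{\<omega> \<in> space (wolff_law J N). \<omega> k i = c} \<in> sets (wolff_law J N)" for k i c
    proof -
      have "(\<lambda>\<omega>. \<omega> k) \<in> measurable (wolff_law J N) (count_space UNIV)"
        using measurable_component_singleton[of k UNIV "\<lambda>_. count_space UNIV"]
        by (simp add: wolff_law_def measurable_cong_sets[OF sets_chain_law refl])
      from measurable_sets[OF this, of "{s. s i = c}"] show ?thesis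
        by (simp add: vimage_def Int_def conj_commute)
    qed
    have inner: "map (\<omega> k) [0..<N] = m \<longleftrightarrow> length m = N \<and> (\<forall>i<N. \<omega> k i = m ! i)"
      for \<omega> :: "nat \<Rightarrow> nat \<Rightarrow> int" and k m
      by (auto simp: list_eq_iff_nth_eq)
    have outer: "map F [0..<M] = l \<longleftrightarrow> length l = M \<and> (\<forall>k<M. F k = l ! k)" for F
      by (auto simp: list_eq_iff_nth_eq)
    have "g -` {l} \<inter> space (wolff_law J N) =
      {\<omega> \<in> space (wolff_law J N). length l = M \<and>
        (\<forall>k\<in>{..<M}. length (l ! k) = N \<and> (\<forall>i\<in>{..<N}. \<omega> k i = l ! k ! i))}"
      unfolding g_def vimage_def singleton_iff outer inner by blast
    also have "\<dots> \<in> sets (wolff_law J N)"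
      by (intro sets.sets_Collect_conj sets.sets_Collect_const sets.sets_Collect_finite_All comp) auto
    finally show "g -` {l} \<inter> space (wolff_law J N) \<in> sets (wolff_law J N)" .
  qed auto
  then have "(\<lambda>\<omega>. f (h (g \<omega>))) \<in> borel_measurable (wolff_law J N)"
    by (rule measurable_compose) simp
  then show ?thesis by (simp add: sc)
qed

end

theory Submission
  imports Defs
begin

text \<open>
  Let \<open>c i j\<close> be the correlation of the spins \<open>i\<close> and \<open>j\<close> under the Gibbs measure, and let
  \<open>T i j\<close> be the sum over the \<open>M\<close> observations of \<open>\<sigma> i * \<sigma> j - c i j\<close>. The entry \<open>(i, j)\<close> of the
  sample covariance matrix is \<open>c i j / N + T i j / (M * N)\<close>. The Cauchy-Schwarz inequality within
  a row, and the sum over all rows in place of the maximum, bound the squared row sum norm by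
  twice the maximal squared row sum of \<open>c / N\<close> plus \<open>2 / (M\<^sup>2 * N)\<close> times the sum of all \<open>(T i j)\<^sup>2\<close>
  (\<open>row_sum_square_decomposition\<close>). The first part is \<open>O(1 / N)\<close>. The second is \<open>O(N\<^sup>2 / M)\<close> in
  expectation as soon as every \<open>(T i j)\<^sup>2\<close> has expectation \<open>O(M * N)\<close>, and this is where
  \<open>N = o(sqrt M)\<close> enters. Both parts rest on one functional inequality.

  The inequality is the Poincare inequality for single-site flips (\<open>gibbs_poincare\<close>), with a constant
  that does not depend on \<open>N\<close>: the variance of \<open>u\<close> is at most a constant times the sum over the
  sites \<open>i\<close> of the mean square of the change of \<open>u\<close> when spin \<open>i\<close> is flipped. In dimension one it
  holds at every temperature, because the two neighbours of a site together influence its conditional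
  law by \<open>tanh (2 * J) < 1\<close> in total. So the heat bath contracts the largest change under a flip
  by the factor \<open>1 - \<theta> / N\<close> with \<open>\<theta> = 1 - tanh (2 * J)\<close>. The heat bath being symmetric, the same
  factor governs its action on mean-zero functions in the mean square sense
  (\<open>heat_bath_L2_contraction\<close>).

  Applied to a sum of spins with signs, the Poincare inequality gives a variance of order \<open>N\<close>, and
  with the signs of one row of \<open>c\<close> this bounds the row sum of \<open>\<bar>c i j\<bar>\<close> by \<open>O(sqrt N)\<close>
  (\<open>corr_row_sum\<close>).

  It also yields a spectral gap of order \<open>1 / N\<close> for the Wolff dynamics (\<open>wolff_spectral_gap\<close>):
  with probability at least \<open>exp (- 4 * J)\<close> both edges at the chosen site are closed, the
  cluster is that single site, and so the Dirichlet form of the Wolff chain dominates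
  \<open>exp (- 4 * J) / N\<close> times the one of single flips. The Gibbs measure is stationary because
  flipping a cluster preserves the joint weight of spins and open edges (\<open>wolff_stationary\<close>).

  For a stationary chain with gap \<open>\<gamma>\<close>, the second moment of a sum of \<open>M\<close> observations of a mean-zero
  \<open>f\<close> is at most \<open>4 * M / \<gamma>\<close> times the mean of \<open>f\<^sup>2\<close> (\<open>additive_functional_second_moment\<close>).
  The gap is the one of the Dirichlet form, which does not see how close the spectrum comes to
  \<open>-1\<close>. This matters, because the Wolff chain can be periodic: for \<open>J = 0\<close> it flips exactly one spin in each step. With \<open>\<gamma>\<close> of order \<open>1 / N\<close>, the
  expectation of \<open>(T i j)\<^sup>2\<close> is \<open>O(M * N)\<close>.
\<close>

section \<open>Two inequalities\<close>

lemma expectation_Cauchy_Schwarz: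
  fixes u v :: "'a \<Rightarrow> real"
  assumes fin: "finite (set_pmf p)"
  shows "(measure_pmf.expectation p (\<lambda>x. u x * v x))\<^sup>2
    \<le> measure_pmf.expectation p (\<lambda>x. (u x)\<^sup>2) * measure_pmf.expectation p (\<lambda>x. (v x)\<^sup>2)"
proof -
  have E: "measure_pmf.expectation p f = (\<Sum>x\<in>set_pmf p. f x * pmf p x)" for f :: "'a \<Rightarrow> real"
    by (rule integral_measure_pmf_real[OF fin])
  show ?thesis
    using Cauchy_Schwarz_ineq_sum[of "\<lambda>x. u x * sqrt (pmf p x)" "\<lambda>x. v x * sqrt (pmf p x)" "set_pmf p"]
    by (simp add: E power_mult_distrib mult.assoc mult.left_commute real_sqrt_mult_self
        flip: power2_eq_square)
qed

text \<open>
  Log-convexity makes the ratios of consecutive terms increase, so no ratio can exceed the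
  exponential rate of the whole sequence. This turns an asymptotic rate, known up to a factor
  \<open>C\<close>, into a bound for the first step that has no such factor.
\<close>

lemma log_convex_ratio_le:
  fixes a :: "nat \<Rightarrow> real"
  assumes nonneg: "\<And>n. 0 \<le> a n" and convex: "\<And>n. (a (Suc n))\<^sup>2 \<le> a n * a (Suc (Suc n))"
    and decay: "\<And>n. a n \<le> C * q ^ n" and "0 < q"
  shows "a 1 \<le> q * a 0"
proof (rule ccontr)
  assume *: "\<not> a 1 \<le> q * a 0"
  have "a 0 \<noteq> 0"
    using * convex[of 0] by (auto simp: power2_eq_square mult_le_0_iff)
  then have "a 0 > 0" using nonneg[of 0] by simp
  define s where "s = a 1 / a 0"
  have "q < s" using * \<open>a 0 > 0\<close> by (simp add: s_def field_simps)
  then have "s > 0" using \<open>0 < q\<close> by simp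
  have step: "a n > 0 \<and> a (Suc n) \<ge> s * a n" for n
  proof (induction n)
    case 0
    show ?case using \<open>a 0 > 0\<close> by (simp add: s_def)
  next
    case (Suc n)
    then have pos: "a (Suc n) > 0" using \<open>s > 0\<close> by (smt (verit) mult_pos_pos)
    have "(s * a n) * a (Suc n) \<le> a (Suc n) * a (Suc n)"
      using Suc pos by (intro mult_right_mono) auto
    also have "\<dots> \<le> a n * a (Suc (Suc n))"
      using convex[of n] by (simp add: power2_eq_square)
    finally have "a n * (s * a (Suc n)) \<le> a n * a (Suc (Suc n))"
      by (simp only: mult_ac)
    then have "s * a (Suc n) \<le> a (Suc (Suc n))"
      using Suc by (simp only: mult_le_cancel_left_pos)
    then show ?case using pos by simp
  qed
  have lower: "s ^ n * a 0 \<le> a n" for n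
  proof (induction n)
    case (Suc n)
    have "s * (s ^ n * a 0) \<le> s * a n" using Suc \<open>s > 0\<close> by simp
    then show ?case using step[of n] by (simp add: mult_ac)
  qed simp
  obtain n where n: "C / a 0 < (s / q) ^ n"
    using real_arch_pow[of "s / q" "C / a 0"] \<open>q < s\<close> \<open>0 < q\<close> by auto
  have "C * q ^ n < s ^ n * a 0"
    using n \<open>a 0 > 0\<close> \<open>0 < q\<close> by (simp add: power_divide field_simps)
  with lower[of n] decay[of n] show False by simp
qed

section \<open>Additive functionals of a stationary Markov chain\<close>

locale finite_stationary_chain =
  fixes p :: "'s pmf" and K :: "'s \<Rightarrow> 's pmf"
  assumes finite_support: "finite (set_pmf p)"
    and stationary: "bind_pmf p K = p"
begin

abbreviation E :: "('s \<Rightarrow> real) \<Rightarrow> real" where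
  "E u \<equiv> measure_pmf.expectation p u"

definition P :: "('s \<Rightarrow> real) \<Rightarrow> 's \<Rightarrow> real" where
  "P u x = measure_pmf.expectation (K x) u"

lemma step_closed: "x \<in> set_pmf p \<Longrightarrow> set_pmf (K x) \<subseteq> set_pmf p"
  using arg_cong[OF stationary, of set_pmf] by auto

lemma finite_step: "x \<in> set_pmf p \<Longrightarrow> finite (set_pmf (K x))"
  using step_closed finite_support finite_subset by blast

lemma integrable_E [simp]: "integrable p (u :: 's \<Rightarrow> real)"
  by (rule integrable_measure_pmf_finite[OF finite_support])

lemma E_sum: "E u = (\<Sum>x\<in>set_pmf p. pmf p x * u x)"
  by (simp add: integral_measure_pmf[OF finite_support])

lemma P_sum: "x \<in> set_pmf p \<Longrightarrow> P u x = (\<Sum>y\<in>set_pmf p. pmf (K x) y * u y)"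
  unfolding P_def
  using step_closed[of x] by (subst integral_measure_pmf[OF finite_support]) auto

lemma E_cong: "(\<And>x. x \<in> set_pmf p \<Longrightarrow> u x = v x) \<Longrightarrow> E u = E v"
  by (simp add: E_sum)

lemma E_mono: "(\<And>x. x \<in> set_pmf p \<Longrightarrow> u x \<le> v x) \<Longrightarrow> E u \<le> E v"
  by (simp add: E_sum sum_mono mult_left_mono)

lemma E_P: "E (P u) = E u"
proof -
  have "E u = measure_pmf.expectation (bind_pmf p K) u"
    by (simp add: stationary)
  also have "\<dots> = E (P u)"
    by (subst pmf_expectation_bind[OF finite_support])
       (auto simp: finite_step E_sum P_def)
  finally show ?thesis ..
qed

lemma E_P_power: "E ((P ^^ n) u) = E u"
  by (induction n) (simp_all add: E_P)

lemma P_square_le: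
  assumes "x \<in> set_pmf p"
  shows "(P u x)\<^sup>2 \<le> P (\<lambda>y. (u y)\<^sup>2) x"
  using expectation_Cauchy_Schwarz[OF finite_step[OF assms], of u "\<lambda>_. 1"]
  by (simp add: P_def)

lemma E_P_square_le: "E (\<lambda>x. (P u x)\<^sup>2) \<le> E (\<lambda>x. (u x)\<^sup>2)"
  using E_mono[of "\<lambda>x. (P u x)\<^sup>2" "P (\<lambda>y. (u y)\<^sup>2)"] P_square_le E_P[of "\<lambda>x. (u x)\<^sup>2"]
  by (metis (no_types, lifting))

lemma E_P_power_square_le: "E (\<lambda>x. ((P ^^ n) u x)\<^sup>2) \<le> E (\<lambda>x. (u x)\<^sup>2)"
  by (induction n) (auto intro: order_trans[OF E_P_square_le])

text \<open>
  Expand the square; stationarity gives the squares at the two ends of a step the same mean.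
\<close>

lemma dirichlet_form:
  "E (\<lambda>x. u x * (u x - P u x)) = E (\<lambda>x. measure_pmf.expectation (K x) (\<lambda>y. (u y - u x)\<^sup>2)) / 2"
proof -
  have "measure_pmf.expectation (K x) (\<lambda>y. (u y - u x)\<^sup>2)
      = P (\<lambda>y. (u y)\<^sup>2) x - 2 * u x * P u x + (u x)\<^sup>2" if x: "x \<in> set_pmf p" for x
  proof -
    have [simp]: "integrable (K x) (v :: _ \<Rightarrow> real)" for v
      by (rule integrable_measure_pmf_finite[OF finite_step[OF x]])
    have "measure_pmf.expectation (K x) (\<lambda>y. (u y - u x)\<^sup>2)
      = measure_pmf.expectation (K x) (\<lambda>y. (u y)\<^sup>2 - 2 * u x * u y + (u x)\<^sup>2)"
      by (simp add: power2_diff algebra_simps)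
    then show ?thesis by (simp add: P_def)
  qed
  then have "E (\<lambda>x. measure_pmf.expectation (K x) (\<lambda>y. (u y - u x)\<^sup>2))
      = E (\<lambda>x. P (\<lambda>y. (u y)\<^sup>2) x - 2 * u x * P u x + (u x)\<^sup>2)"
    by (rule E_cong)
  also have "\<dots> = 2 * E (\<lambda>x. (u x)\<^sup>2) - 2 * E (\<lambda>x. u x * P u x)"
    using E_P[of "\<lambda>x. (u x)\<^sup>2"] by (simp add: mult.assoc)
  finally show ?thesis
    by (simp add: right_diff_distrib power2_eq_square)
qed

abbreviation L :: "(nat \<Rightarrow> 's) measure" where
  "L \<equiv> chain_law p K"

text \<open>
  The law of the trajectory is known through its cylinders. Restricted to the finitely many states
  that the stationary law charges, expectations of functions of a finite prefix become finite sums
  over \<open>paths\<close>, on which the Markov property is the factorisation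
  \<open>weight_Suc\<close>.
\<close>

definition cylinder :: "nat \<Rightarrow> (nat \<Rightarrow> 's) \<Rightarrow> (nat \<Rightarrow> 's) set" where
  "cylinder n x = {\<omega>. \<forall>k\<le>n. \<omega> k = x k}"

definition paths :: "nat \<Rightarrow> (nat \<Rightarrow> 's) set" where
  "paths n = ({..n} \<rightarrow>\<^sub>E set_pmf p)"

definition weight :: "nat \<Rightarrow> (nat \<Rightarrow> 's) \<Rightarrow> real" where
  "weight n x = pmf p (x 0) * (\<Prod>k<n. pmf (K (x k)) (x (Suc k)))"

lemma prob_space_L: "prob_space L"
  by (rule prob_space_chain_law)

lemma measurable_coordinate [measurable]: "(\<lambda>\<omega>. \<omega> k) \<in> measurable L (count_space UNIV)"
  using measurable_component_singleton[of k UNIV "\<lambda>_. count_space UNIV"]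
  by (simp add: measurable_cong_sets[OF sets_chain_law refl])

lemma measurable_of_coordinate [measurable]: "(\<lambda>\<omega>. f (\<omega> k)) \<in> borel_measurable L"
  for f :: "'s \<Rightarrow> real"
  by (rule measurable_compose[OF measurable_coordinate]) simp

lemma sets_cylinder [measurable]: "cylinder n x \<in> sets L"
proof -
  have "cylinder n x = (\<Inter>k\<in>{..n}. (\<lambda>\<omega>. \<omega> k) -` {x k} \<inter> space L)"
    by (auto simp: cylinder_def space_chain_law)
  also have "\<dots> \<in> sets L"
    by (intro sets.finite_INT measurable_sets[OF measurable_coordinate]) auto
  finally show ?thesis .
qed

lemma measure_cylinder: "measure L (cylinder n x) = weight n x"
  unfolding cylinder_def measure_def emeasure_chain_law_cylinder
  by (simp add: weight_def prod_nonneg)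

lemma finite_paths: "finite (paths n)"
  by (simp add: paths_def finite_PiE finite_support)

lemma sum_paths_0: "(\<Sum>x\<in>paths 0. \<Phi> x) = (\<Sum>y\<in>set_pmf p. \<Phi> ((\<lambda>_. undefined)(0 := y)))"
proof -
  have img: "paths 0 = (\<lambda>y. (\<lambda>_. undefined)(0 := y)) ` set_pmf p"
    by (simp add: paths_def PiE_insert_eq image_image atMost_0 case_prod_unfold Times_insert_right
        del: fun_upd_apply)
  have inj: "inj_on (\<lambda>y. (\<lambda>_. undefined)(0 := y)) (set_pmf p)"
    by (rule inj_onI) (metis fun_upd_same)
  show ?thesis
    unfolding img by (simp add: sum.reindex[OF inj] o_def del: fun_upd_apply)
qed

lemma sum_paths_Suc:
  "(\<Sum>x\<in>paths (Suc n). \<Phi> x) = (\<Sum>x\<in>paths n. \<Sum>y\<in>set_pmf p. \<Phi> (x(Suc n := y)))"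
proof -
  have "paths (Suc n) = (\<lambda>(y, g). g(Suc n := y)) ` (set_pmf p \<times> paths n)"
    unfolding paths_def by (simp add: atMost_Suc PiE_insert_eq)
  moreover have "inj_on (\<lambda>(y, g). g(Suc n := y)) (set_pmf p \<times> paths n)"
    unfolding paths_def by (rule inj_combinator) simp
  ultimately have "(\<Sum>x\<in>paths (Suc n). \<Phi> x) = (\<Sum>(y, x)\<in>set_pmf p \<times> paths n. \<Phi> (x(Suc n := y)))"
    by (simp add: sum.reindex case_prod_unfold)
  also have "\<dots> = (\<Sum>x\<in>paths n. \<Sum>y\<in>set_pmf p. \<Phi> (x(Suc n := y)))"
    by (subst sum.cartesian_product[symmetric]) (rule sum.swap)
  finally show ?thesis .
qed

lemma weight_Suc: "weight (Suc n) (x(Suc n := y)) = weight n x * pmf (K (x n)) y"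
  by (simp add: weight_def)

lemma sum_weight: "(\<Sum>x\<in>paths n. weight n x) = 1"
proof (induction n)
  case 0
  show ?case
    by (simp add: sum_paths_0 weight_def sum_pmf_eq_1[OF finite_support])
next
  case (Suc n)
  have "x n \<in> set_pmf p" if "x \<in> paths n" for x
    using that by (auto simp: paths_def)
  then have "(\<Sum>y\<in>set_pmf p. pmf (K (x n)) y) = 1" if "x \<in> paths n" for x
    using that finite_support step_closed by (intro sum_pmf_eq_1) auto
  then show ?case
    by (simp add: sum_paths_Suc weight_Suc Suc.IH flip: sum_distrib_left)
qed

lemma AE_prefix: "AE \<omega> in L. \<forall>k\<le>n. \<omega> k \<in> set_pmf p"
proof -
  interpret prob_space L by (rule prob_space_L)
  have disj: "disjoint_family_on (cylinder n) (paths n)"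
    unfolding disjoint_family_on_def
  proof (intro ballI impI, rule ccontr)
    fix x x' assume x: "x \<in> paths n" "x' \<in> paths n" "x \<noteq> x'" "cylinder n x \<inter> cylinder n x' \<noteq> {}"
    then have "\<forall>k\<in>{..n}. x k = x' k" by (auto simp: cylinder_def)
    with x show False by (auto simp: paths_def intro: PiE_ext)
  qed
  have "prob (\<Union>x\<in>paths n. cylinder n x) = (\<Sum>x\<in>paths n. prob (cylinder n x))"
    by (intro finite_measure_finite_Union finite_paths disj) auto
  also have "\<dots> = 1"
    by (simp add: measure_cylinder sum_weight)
  finally have "AE \<omega> in L. \<omega> \<in> (\<Union>x\<in>paths n. cylinder n x)"
    by (subst prob_eq_1[symmetric]) (auto simp: finite_paths)
  then show ?thesis
    by eventually_elim (auto simp: cylinder_def paths_def)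
qed

lemma AE_support: "AE \<omega> in L. \<forall>k. \<omega> k \<in> set_pmf p"
  using AE_prefix by (auto simp: AE_all_countable)

lemma expectation_prefix:
  fixes F :: "(nat \<Rightarrow> 's) \<Rightarrow> real"
  assumes [measurable]: "F \<in> borel_measurable L"
    and F: "\<And>\<omega> \<omega>'. (\<And>k. k \<le> n \<Longrightarrow> \<omega> k = \<omega>' k) \<Longrightarrow> F \<omega> = F \<omega>'"
  shows "(\<integral>\<omega>. F \<omega> \<partial>L) = (\<Sum>x\<in>paths n. weight n x * F x)"
proof -
  interpret prob_space L by (rule prob_space_L)
  have "AE \<omega> in L. F \<omega> = (\<Sum>x\<in>paths n. F x * indicator (cylinder n x) \<omega>)"
    using AE_prefix[of n]
  proof eventually_elim
    case (elim \<omega>)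
    let ?x = "restrict \<omega> {..n}"
    have x: "?x \<in> paths n" using elim by (auto simp: paths_def)
    have "\<omega> \<in> cylinder n x \<longleftrightarrow> x = ?x" if "x \<in> paths n" for x
      using that by (auto simp: cylinder_def paths_def PiE_iff extensional_def fun_eq_iff)
    then have "(\<Sum>x\<in>paths n. F x * indicator (cylinder n x) \<omega>)
        = (\<Sum>x\<in>paths n. if x = ?x then F x else 0)"
      by (intro sum.cong) (auto simp: indicator_def)
    also have "\<dots> = F ?x" using x by (simp add: finite_paths)
    also have "\<dots> = F \<omega>" by (rule F) simp
    finally show ?case ..
  qed
  then have "(\<integral>\<omega>. F \<omega> \<partial>L) = (\<integral>\<omega>. (\<Sum>x\<in>paths n. F x * indicator (cylinder n x) \<omega>) \<partial>L)"
    by (intro integral_cong_AE) auto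
  also have "\<dots> = (\<Sum>x\<in>paths n. F x * prob (cylinder n x))"
    by (subst Bochner_Integration.integral_sum) (auto intro!: integrable_real_indicator simp: emeasure_eq_measure)
  finally show ?thesis by (simp add: measure_cylinder mult.commute)
qed

lemma integrable_L:
  fixes f g :: "'s \<Rightarrow> real"
  shows "integrable L (\<lambda>\<omega>. f (\<omega> k) * g (\<omega> l))"
proof -
  interpret prob_space L by (rule prob_space_L)
  define b where "b u = (\<Sum>x\<in>set_pmf p. \<bar>u x\<bar>)" for u :: "'s \<Rightarrow> real"
  have b: "\<bar>u x\<bar> \<le> b u" if "x \<in> set_pmf p" for u x
    unfolding b_def using that finite_support by (intro member_le_sum) auto
  show ?thesis
  proof (rule integrable_const_bound)
    show "AE \<omega> in L. norm (f (\<omega> k) * g (\<omega> l)) \<le> b f * b g"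
      using AE_support by eventually_elim (auto simp: abs_mult intro!: mult_mono b b[THEN order_trans[OF abs_ge_zero]])
  qed measurable
qed

lemma markov_property:
  fixes f g :: "'s \<Rightarrow> real"
  assumes "k \<le> n"
  shows "(\<integral>\<omega>. f (\<omega> k) * g (\<omega> (Suc n)) \<partial>L) = (\<integral>\<omega>. f (\<omega> k) * P g (\<omega> n) \<partial>L)"
proof -
  have "(\<integral>\<omega>. f (\<omega> k) * g (\<omega> (Suc n)) \<partial>L)
      = (\<Sum>x\<in>paths (Suc n). weight (Suc n) x * (f (x k) * g (x (Suc n))))"
    using assms by (intro expectation_prefix) auto
  also have "\<dots> = (\<Sum>x\<in>paths n. \<Sum>y\<in>set_pmf p. weight n x * pmf (K (x n)) y * (f (x k) * g y))"
    unfolding sum_paths_Suc weight_Suc using assms by simp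
  also have "\<dots> = (\<Sum>x\<in>paths n. weight n x * (f (x k) * P g (x n)))"
  proof (rule sum.cong[OF refl])
    fix x assume "x \<in> paths n"
    then have "x n \<in> set_pmf p" by (auto simp: paths_def)
    then show "(\<Sum>y\<in>set_pmf p. weight n x * pmf (K (x n)) y * (f (x k) * g y))
        = weight n x * (f (x k) * P g (x n))"
      by (simp add: P_sum sum_distrib_left mult_ac)
  qed
  also have "\<dots> = (\<integral>\<omega>. f (\<omega> k) * P g (\<omega> n) \<partial>L)"
    using assms by (intro expectation_prefix[symmetric]) auto
  finally show ?thesis .
qed

lemma expectation_coordinate: "(\<integral>\<omega>. f (\<omega> k) \<partial>L) = E f" for f :: "'s \<Rightarrow> real"
proof (induction k arbitrary: f)
  case 0
  have "(\<integral>\<omega>. f (\<omega> 0) \<partial>L) = (\<Sum>x\<in>paths 0. weight 0 x * f (x 0))"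
    by (intro expectation_prefix) auto
  then show ?case
    by (simp add: sum_paths_0 weight_def E_sum)
next
  case (Suc k)
  show ?case
    using markov_property[of k k "\<lambda>_. 1" f] Suc.IH[of "P f"] by (simp add: E_P)
qed

lemma expectation_two_times:
  "(\<integral>\<omega>. f (\<omega> k) * g (\<omega> (k + d)) \<partial>L) = E (\<lambda>x. f x * (P ^^ d) g x)" for f g :: "'s \<Rightarrow> real"
proof (induction d arbitrary: g)
  case 0
  show ?case using expectation_coordinate[of "\<lambda>x. f x * g x" k] by simp
next
  case (Suc d)
  show ?case
    using markov_property[of k "k + d" f g] Suc.IH[of "P g"] by (simp add: funpow_swap1)
qed

text \<open>
  The sum \<open>u\<close> of the first \<open>m\<close> images of \<open>f\<close> under
  \<open>P\<close> solves \<open>u - P u = f - P\<^sup>m f\<close>, a Poisson equation up to a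
  remainder no larger than \<open>f\<close> in mean square. The gap therefore bounds
  \<open>u\<close> by \<open>2 / \<gamma>\<close> times \<open>f\<close> in mean square, uniformly
  in \<open>m\<close> and whatever the spectrum of \<open>P\<close> near \<open>-1\<close> is.
\<close>

lemma occupation_sum_bound:
  assumes gap: "\<And>u. E u = 0 \<Longrightarrow> \<gamma> * E (\<lambda>x. (u x)\<^sup>2) \<le> E (\<lambda>x. u x * (u x - P u x))"
    and "\<gamma> > 0" and f: "E f = 0"
  shows "\<bar>E (\<lambda>x. f x * (\<Sum>n<m. (P ^^ n) f x))\<bar> \<le> 2 * E (\<lambda>x. (f x)\<^sup>2) / \<gamma>"
proof -
  define u where "u x = (\<Sum>n<m. (P ^^ n) f x)" for x
  define r where "r x = f x - (P ^^ m) f x" for x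
  define A where "A = E (\<lambda>x. (u x)\<^sup>2)"
  define B where "B = E (\<lambda>x. (f x)\<^sup>2)"
  have nn: "0 \<le> A" "0 \<le> B" by (simp_all add: A_def B_def)
  have "E u = 0"
    unfolding u_def by (simp add: E_P_power f)
  have "u x - P u x = r x" if x: "x \<in> set_pmf p" for x
  proof -
    have "P u x = (\<Sum>n<m. (P ^^ Suc n) f x)"
      using x unfolding u_def[abs_def]
      by (simp add: P_sum sum_distrib_left) (rule sum.swap)
    then have "u x - P u x = (\<Sum>n<m. (P ^^ n) f x - (P ^^ Suc n) f x)"
      by (simp add: u_def sum_subtractf)
    also have "\<dots> = r x"
      unfolding r_def by (subst sum_lessThan_telescope') simp
    finally show ?thesis .
  qed
  then have "E (\<lambda>x. u x * (u x - P u x)) = E (\<lambda>x. u x * r x)"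
    by (intro E_cong) simp
  with gap[OF \<open>E u = 0\<close>] have 1: "\<gamma> * A \<le> E (\<lambda>x. u x * r x)"
    by (simp add: A_def)
  have "E (\<lambda>x. (r x)\<^sup>2) \<le> E (\<lambda>x. 2 * (f x)\<^sup>2 + 2 * ((P ^^ m) f x)\<^sup>2)"
    unfolding r_def by (intro E_mono) (smt (verit) sum_squares_bound power2_diff zero_le_power2 power2_sum)
  also have "\<dots> \<le> 4 * B"
    using E_P_power_square_le[of m f] by (simp add: B_def)
  finally have r: "E (\<lambda>x. (r x)\<^sup>2) \<le> 4 * B" .
  have "(\<gamma> * A)\<^sup>2 \<le> (E (\<lambda>x. u x * r x))\<^sup>2"
    using 1 nn \<open>\<gamma> > 0\<close> by (intro power_mono) auto
  also have "\<dots> \<le> A * E (\<lambda>x. (r x)\<^sup>2)"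
    unfolding A_def by (rule expectation_Cauchy_Schwarz[OF finite_support])
  also have "\<dots> \<le> A * (4 * B)"
    using nn r by (intro mult_left_mono)
  finally have "A * (\<gamma>\<^sup>2 * A) \<le> A * (4 * B)"
    by (simp add: power2_eq_square mult_ac)
  then have A: "\<gamma>\<^sup>2 * A \<le> 4 * B"
    using nn by (cases "A = 0") auto
  have "(E (\<lambda>x. f x * u x))\<^sup>2 \<le> B * A"
    unfolding A_def B_def by (rule expectation_Cauchy_Schwarz[OF finite_support])
  then have "\<gamma>\<^sup>2 * (E (\<lambda>x. f x * u x))\<^sup>2 \<le> \<gamma>\<^sup>2 * (B * A)"
    by (intro mult_left_mono) auto
  also have "\<dots> \<le> B * (4 * B)"
    using mult_left_mono[OF A, of B] nn by (simp add: mult_ac)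
  also have "\<dots> = (2 * B)\<^sup>2" by (simp add: power2_eq_square)
  finally have "\<bar>\<gamma> * E (\<lambda>x. f x * u x)\<bar> \<le> \<bar>2 * B\<bar>"
    by (intro abs_le_square_iff[THEN iffD2]) (simp add: power_mult_distrib)
  then show ?thesis
    using \<open>\<gamma> > 0\<close> nn unfolding u_def B_def[symmetric]
    by (simp add: abs_mult field_simps)
qed

text \<open>
  Adding the observation at time \<open>M\<close> increases the second moment by at most twice the
  sum of the covariances with all times up to \<open>M\<close>. By stationarity this is the sum of
  the autocovariances of lags \<open>0, \<dots>, M\<close>, which
  \<open>occupation_sum_bound\<close> controls as a whole.
\<close>

lemma additive_functional_second_moment:
  assumes gap: "\<And>u. E u = 0 \<Longrightarrow> \<gamma> * E (\<lambda>x. (u x)\<^sup>2) \<le> E (\<lambda>x. u x * (u x - P u x))"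
    and "\<gamma> > 0" and f: "E f = 0"
  shows "integrable L (\<lambda>\<omega>. (\<Sum>k<M. f (\<omega> k))\<^sup>2)"
    and "(\<integral>\<omega>. (\<Sum>k<M. f (\<omega> k))\<^sup>2 \<partial>L) \<le> real M * (4 * E (\<lambda>x. (f x)\<^sup>2) / \<gamma>)"
proof -
  have int: "integrable L (\<lambda>\<omega>. (\<Sum>k<M. f (\<omega> k))\<^sup>2)" for M
    unfolding power2_eq_square sum_product
    by (intro Bochner_Integration.integrable_sum integrable_L)
  then show "integrable L (\<lambda>\<omega>. (\<Sum>k<M. f (\<omega> k))\<^sup>2)" .
  show "(\<integral>\<omega>. (\<Sum>k<M. f (\<omega> k))\<^sup>2 \<partial>L) \<le> real M * (4 * E (\<lambda>x. (f x)\<^sup>2) / \<gamma>)"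
  proof (induction M)
    case 0
    then show ?case by simp
  next
    case (Suc M)
    let ?T = "\<lambda>\<omega>. \<Sum>k<M. f (\<omega> k)"
    let ?C = "\<lambda>\<omega>. \<Sum>k\<le>M. f (\<omega> k) * f (\<omega> M)"
    \<comment> \<open>The square of \<open>f (\<omega> M)\<close> occurs once on the left and twice on the right.\<close>
    have "(\<Sum>k<Suc M. f (\<omega> k))\<^sup>2 \<le> (?T \<omega>)\<^sup>2 + 2 * ?C \<omega>" for \<omega>
      by (simp add: power2_eq_square algebra_simps lessThan_Suc_atMost[symmetric] sum_distrib_left)
    moreover have intC: "integrable L ?C"
      by (intro Bochner_Integration.integrable_sum integrable_L)
    ultimately have "(\<integral>\<omega>. (\<Sum>k<Suc M. f (\<omega> k))\<^sup>2 \<partial>L) \<le> (\<integral>\<omega>. (?T \<omega>)\<^sup>2 + 2 * ?C \<omega> \<partial>L)"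
      by (intro integral_mono int Bochner_Integration.integrable_add integrable_mult_right)
    also have "\<dots> = (\<integral>\<omega>. (?T \<omega>)\<^sup>2 \<partial>L) + 2 * (\<integral>\<omega>. ?C \<omega> \<partial>L)"
      using int[of M] intC by simp
    also have "(\<integral>\<omega>. ?C \<omega> \<partial>L) = (\<Sum>k\<le>M. E (\<lambda>x. f x * (P ^^ (M - k)) f x))"
    proof (subst Bochner_Integration.integral_sum, rule integrable_L, rule sum.cong[OF refl])
      fix k assume "k \<in> {..M}"
      then show "(\<integral>\<omega>. f (\<omega> k) * f (\<omega> M) \<partial>L) = E (\<lambda>x. f x * (P ^^ (M - k)) f x)"
        using expectation_two_times[of f k f "M - k"] by simp
    qed
    also have "\<dots> = (\<Sum>d<Suc M. E (\<lambda>x. f x * (P ^^ d) f x))"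
      unfolding lessThan_Suc_atMost
      by (rule sum.reindex_bij_witness[of _ "\<lambda>d. M - d" "\<lambda>d. M - d"]) auto
    also have "\<dots> = E (\<lambda>x. f x * (\<Sum>d<Suc M. (P ^^ d) f x))"
      by (simp add: sum_distrib_left del: sum.lessThan_Suc)
    also have "\<dots> \<le> 2 * E (\<lambda>x. (f x)\<^sup>2) / \<gamma>"
      using occupation_sum_bound[OF gap \<open>\<gamma> > 0\<close> f, of "Suc M"] by linarith
    finally show ?case
      using Suc.IH by (simp add: distrib_right add_divide_distrib)
  qed
qed

end

section \<open>The Poincare inequality for the Ising ring\<close>

lemma logistic_symmetric: "1 / (1 + exp (- x)) = 1 - 1 / (1 + exp x)" for x :: real
proof -
  have "1 + exp x \<noteq> 0" "exp x + 1 \<noteq> 0" using exp_gt_zero[of x] by linarith+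
  then show ?thesis by (simp add: exp_minus field_simps)
qed

definition pred_site :: "nat \<Rightarrow> nat \<Rightarrow> nat" where
  "pred_site N i = (if i = 0 then N - 1 else i - 1)"

lemma flip_flip [simp]: "flip C (flip C \<sigma>) = \<sigma>"
  by (auto simp: flip_def)

lemma flip_commute: "flip C (flip D \<sigma>) = flip D (flip C \<sigma>)"
  by (auto simp: flip_def)

lemma flip_in_configs:
  assumes "C \<subseteq> {..<N}" "\<sigma> \<in> configs N"
  shows "flip C \<sigma> \<in> configs N"
  using assms unfolding configs_def PiE_iff extensional_def flip_def by auto

lemma spin_cases: "\<sigma> \<in> configs N \<Longrightarrow> i < N \<Longrightarrow> \<sigma> i = -1 \<or> \<sigma> i = 1"
  by (auto simp: configs_def PiE_iff)

lemma bij_flip: "C \<subseteq> {..<N} \<Longrightarrow> bij_betw (flip C) (configs N) (configs N)"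
  by (rule bij_betwI[of _ _ _ "flip C"]) (auto intro: flip_in_configs)

lemma cyc_less: "i < N \<Longrightarrow> cyc N i < N"
  by (auto simp: cyc_def)

lemma cyc_pred: "i < N \<Longrightarrow> cyc N (pred_site N i) = i"
  by (auto simp: cyc_def pred_site_def)

lemma pred_less: "i < N \<Longrightarrow> pred_site N i < N"
  by (auto simp: pred_site_def)

lemma cyc_eq_iff: "e < N \<Longrightarrow> i < N \<Longrightarrow> cyc N e = i \<longleftrightarrow> e = pred_site N i"
  unfolding cyc_def pred_site_def by (cases "Suc e = N") auto

text \<open>
  From \<open>N = 3\<close> on, the two neighbours of a site are distinct from each other and from
  the site.
\<close>

locale ising_ring =
  fixes J :: real and N :: nat
  assumes J_nonneg: "0 \<le> J" and N_ge_3: "3 \<le> N"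
begin

abbreviation E :: "((nat \<Rightarrow> int) \<Rightarrow> real) \<Rightarrow> real" where
  "E u \<equiv> measure_pmf.expectation (gibbs J N) u"

text \<open>
  This is \<open>1 - tanh (2 * J)\<close>.
\<close>

definition \<theta> :: real where
  "\<theta> = 2 / (1 + exp (4 * J))"

lemma neighbours: "i < N \<Longrightarrow> cyc N i \<noteq> i" "i < N \<Longrightarrow> pred_site N i \<noteq> i" "i < N \<Longrightarrow> cyc N i \<noteq> pred_site N i"
  using N_ge_3 by (auto simp: cyc_def pred_site_def mod_if split: if_splits)

lemma set_pmf_gibbs: "set_pmf (gibbs J N) = configs N"
  using partition_function_pos[of J N]
  by (auto simp: set_pmf_eq pmf_gibbs gibbs_weight_def)

lemma finite_gibbs: "finite (set_pmf (gibbs J N))"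
  by (simp add: set_pmf_gibbs finite_configs)

lemma integrable_gibbs [simp]: "integrable (gibbs J N) (u :: _ \<Rightarrow> real)"
  by (rule integrable_measure_pmf_finite[OF finite_gibbs])

lemma E_sum: "E u = (\<Sum>\<sigma>\<in>configs N. pmf (gibbs J N) \<sigma> * u \<sigma>)"
  by (simp add: integral_measure_pmf[OF finite_gibbs] flip: set_pmf_gibbs)

lemma E_cong: "(\<And>\<sigma>. \<sigma> \<in> configs N \<Longrightarrow> u \<sigma> = v \<sigma>) \<Longrightarrow> E u = E v"
  by (simp add: E_sum)

lemma E_mono: "(\<And>\<sigma>. \<sigma> \<in> configs N \<Longrightarrow> u \<sigma> \<le> v \<sigma>) \<Longrightarrow> E u \<le> E v"
  by (simp add: E_sum sum_mono mult_left_mono)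

text \<open>
  Flipping spin \<open>i\<close> lowers the exponent of the Gibbs weight by \<open>2 * J * alignment
  i \<sigma>\<close>, so \<open>flip_rate i \<sigma>\<close> below is the conditional probability,
  given the other spins, that spin \<open>i\<close> is opposite to its value in
  \<open>\<sigma>\<close>.
\<close>

definition alignment :: "nat \<Rightarrow> (nat \<Rightarrow> int) \<Rightarrow> real" where
  "alignment i \<sigma> = real_of_int (\<sigma> i * (\<sigma> (pred_site N i) + \<sigma> (cyc N i)))"

definition flip_rate :: "nat \<Rightarrow> (nat \<Rightarrow> int) \<Rightarrow> real" where
  "flip_rate i \<sigma> = 1 / (1 + exp (2 * J * alignment i \<sigma>))"

lemma energy_flip:
  assumes i: "i < N"
  shows "(\<Sum>e<N. real_of_int (\<sigma> e * \<sigma> (cyc N e)))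
    = (\<Sum>e<N. real_of_int (flip {i} \<sigma> e * flip {i} \<sigma> (cyc N e))) + 2 * alignment i \<sigma>"
proof -
  have "real_of_int (\<sigma> e * \<sigma> (cyc N e)) - real_of_int (flip {i} \<sigma> e * flip {i} \<sigma> (cyc N e))
     = (if e = i then 2 * real_of_int (\<sigma> i * \<sigma> (cyc N i)) else 0)
      + (if e = pred_site N i then 2 * real_of_int (\<sigma> i * \<sigma> (pred_site N i)) else 0)" if "e < N" for e
    using that i neighbours[of i] cyc_eq_iff[OF that i] cyc_pred[of i N]
    by (auto simp: flip_def)
  then have "(\<Sum>e<N. real_of_int (\<sigma> e * \<sigma> (cyc N e)) - real_of_int (flip {i} \<sigma> e * flip {i} \<sigma> (cyc N e)))
     = (\<Sum>e<N. (if e = i then 2 * real_of_int (\<sigma> i * \<sigma> (cyc N i)) else 0)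
      + (if e = pred_site N i then 2 * real_of_int (\<sigma> i * \<sigma> (pred_site N i)) else 0))"
    by (intro sum.cong) auto
  also have "\<dots> = 2 * alignment i \<sigma>"
    using i pred_less[OF i] by (simp add: sum.distrib alignment_def algebra_simps)
  finally show ?thesis by (simp add: sum_subtractf)
qed

lemma alignment_flip: "i < N \<Longrightarrow> alignment i (flip {i} \<sigma>) = - alignment i \<sigma>"
  using neighbours[of i] by (simp add: alignment_def flip_def)

lemma detailed_balance:
  assumes i: "i < N" and \<sigma>: "\<sigma> \<in> configs N"
  shows "pmf (gibbs J N) (flip {i} \<sigma>) * flip_rate i (flip {i} \<sigma>) = pmf (gibbs J N) \<sigma> * flip_rate i \<sigma>"
proof -
  let ?h = "2 * J * alignment i \<sigma>"
  have "flip {i} \<sigma> \<in> configs N" using i \<sigma> by (intro flip_in_configs) auto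
  moreover have w: "gibbs_weight J N \<sigma> = gibbs_weight J N (flip {i} \<sigma>) * exp ?h"
    unfolding gibbs_weight_def using energy_flip[OF i, of \<sigma>]
    by (simp add: algebra_simps flip: exp_add)
  moreover have "1 / (1 + exp (- ?h)) = exp ?h * (1 / (1 + exp ?h))"
    by (simp add: exp_minus divide_simps add_pos_pos)
  ultimately show ?thesis
    using \<sigma> i unfolding flip_rate_def w
    by (simp only: pmf_gibbs alignment_flip if_True mult_minus_right) (simp add: w)
qed

lemma flip_rate_bounds: "0 \<le> flip_rate i \<sigma>" "flip_rate i \<sigma> \<le> 1"
  by (simp_all add: flip_rate_def add_nonneg_nonneg divide_simps add_pos_pos)

definition resample :: "nat \<Rightarrow> ((nat \<Rightarrow> int) \<Rightarrow> real) \<Rightarrow> (nat \<Rightarrow> int) \<Rightarrow> real" where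
  "resample i u \<sigma> = u \<sigma> + flip_rate i \<sigma> * (u (flip {i} \<sigma>) - u \<sigma>)"

definition heat_bath :: "((nat \<Rightarrow> int) \<Rightarrow> real) \<Rightarrow> (nat \<Rightarrow> int) \<Rightarrow> real" where
  "heat_bath u \<sigma> = (\<Sum>i<N. resample i u \<sigma>) / real N"

text \<open>
  The weight \<open>pmf * flip_rate\<close> is invariant under the flip, so both sides can be
  symmetrised over \<open>\<sigma>\<close> and its flip. The right-hand side is symmetric in
  \<open>u\<close> and \<open>v\<close>; the symmetry of the heat bath, the conservation of means
  and its Dirichlet form are all instances.
\<close>

lemma resample_form:
  assumes i: "i < N"
  shows "E (\<lambda>\<sigma>. (u \<sigma> - resample i u \<sigma>) * v \<sigma>)
    = E (\<lambda>\<sigma>. flip_rate i \<sigma> * ((u (flip {i} \<sigma>) - u \<sigma>) * (v (flip {i} \<sigma>) - v \<sigma>))) / 2"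
proof -
  let ?w = "\<lambda>\<sigma>. pmf (gibbs J N) \<sigma> * flip_rate i \<sigma>"
  let ?A = "\<Sum>\<sigma>\<in>configs N. ?w \<sigma> * ((u \<sigma> - u (flip {i} \<sigma>)) * v \<sigma>)"
  let ?B = "\<Sum>\<sigma>\<in>configs N. ?w \<sigma> * ((u (flip {i} \<sigma>) - u \<sigma>) * v (flip {i} \<sigma>))"
  have "?A = (\<Sum>\<sigma>\<in>configs N. ?w (flip {i} \<sigma>) *
      ((u (flip {i} \<sigma>) - u (flip {i} (flip {i} \<sigma>))) * v (flip {i} \<sigma>)))"
    using i by (intro sum.reindex_bij_betw[symmetric] bij_flip) auto
  also have "\<dots> = ?B"
    using i by (intro sum.cong) (simp_all add: detailed_balance)
  finally have "?A = ?B" .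
  moreover have "E (\<lambda>\<sigma>. (u \<sigma> - resample i u \<sigma>) * v \<sigma>) = ?A"
    unfolding E_sum resample_def by (intro sum.cong) (auto simp: algebra_simps)
  moreover have "E (\<lambda>\<sigma>. flip_rate i \<sigma> * ((u (flip {i} \<sigma>) - u \<sigma>) * (v (flip {i} \<sigma>) - v \<sigma>))) = ?A + ?B"
    unfolding E_sum sum.distrib[symmetric] by (intro sum.cong) (auto simp: algebra_simps)
  ultimately show ?thesis by simp
qed

lemma heat_bath_form:
  "E (\<lambda>\<sigma>. (u \<sigma> - heat_bath u \<sigma>) * v \<sigma>)
    = (\<Sum>i<N. E (\<lambda>\<sigma>. flip_rate i \<sigma> * ((u (flip {i} \<sigma>) - u \<sigma>) * (v (flip {i} \<sigma>) - v \<sigma>)))) / (2 * real N)"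
proof -
  have "(u \<sigma> - heat_bath u \<sigma>) * v \<sigma> = (\<Sum>i<N. (u \<sigma> - resample i u \<sigma>) * v \<sigma>) / real N" for \<sigma>
    unfolding heat_bath_def sum_distrib_right[symmetric] sum_subtractf
    using N_ge_3 by (simp add: diff_divide_distrib left_diff_distrib)
  then have "E (\<lambda>\<sigma>. (u \<sigma> - heat_bath u \<sigma>) * v \<sigma>) = (\<Sum>i<N. E (\<lambda>\<sigma>. (u \<sigma> - resample i u \<sigma>) * v \<sigma>)) / real N"
    by simp
  also have "\<dots> = (\<Sum>i<N. E (\<lambda>\<sigma>. flip_rate i \<sigma> * ((u (flip {i} \<sigma>) - u \<sigma>) * (v (flip {i} \<sigma>) - v \<sigma>))) / 2) / real N"
    by (simp add: resample_form)
  finally show ?thesis by (simp add: sum_divide_distrib)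
qed

lemma heat_bath_symmetric: "E (\<lambda>\<sigma>. heat_bath u \<sigma> * v \<sigma>) = E (\<lambda>\<sigma>. u \<sigma> * heat_bath v \<sigma>)"
proof -
  have "E (\<lambda>\<sigma>. (u \<sigma> - heat_bath u \<sigma>) * v \<sigma>) = E (\<lambda>\<sigma>. (v \<sigma> - heat_bath v \<sigma>) * u \<sigma>)"
    unfolding heat_bath_form by (simp only: mult.commute[of "u _ - u _"])
  then have "E (\<lambda>\<sigma>. u \<sigma> * v \<sigma>) - E (\<lambda>\<sigma>. heat_bath u \<sigma> * v \<sigma>)
      = E (\<lambda>\<sigma>. v \<sigma> * u \<sigma>) - E (\<lambda>\<sigma>. heat_bath v \<sigma> * u \<sigma>)"
    by (simp add: left_diff_distrib)
  then show ?thesis by (simp add: mult.commute)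
qed

lemma E_heat_bath: "E (heat_bath u) = E u"
  using heat_bath_form[of u "\<lambda>_. 1"] by simp

text \<open>
  Lipschitz continuity with respect to the Hamming distance.
\<close>

definition flip_lipschitz :: "real \<Rightarrow> ((nat \<Rightarrow> int) \<Rightarrow> real) \<Rightarrow> bool" where
  "flip_lipschitz D u \<longleftrightarrow> (\<forall>\<sigma>\<in>configs N. \<forall>j<N. \<bar>u (flip {j} \<sigma>) - u \<sigma>\<bar> \<le> D)"

lemma theta_bounds: "0 < \<theta>" "\<theta> \<le> 1"
  using J_nonneg by (simp_all add: \<theta>_def divide_simps add_pos_pos add_nonneg_pos)

lemma contraction_factor_pos: "0 < 1 - \<theta> / real N"
  using N_ge_3 theta_bounds by (simp add: field_simps)

text \<open>
  The product of \<open>a\<close> with the sum of its neighbours moves between \<open>0\<close> and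
  \<open>2\<close> or \<open>-2\<close>, so the logistic function moves between \<open>1/2\<close>
  and one of its values at \<open>4 * J\<close> and \<open>- 4 * J\<close>.
\<close>

lemma flip_rate_influence:
  fixes a b c :: real
  assumes "a \<in> {-1, 1}" "b \<in> {-1, 1}" "c \<in> {-1, 1}"
  shows "\<bar>1 / (1 + exp (2 * J * (a * (- b + c)))) - 1 / (1 + exp (2 * J * (a * (b + c))))\<bar>
    = (1 - \<theta>) / 2"
proof -
  have "1 / (1 + exp (4 * J)) = \<theta> / 2"
    using exp_gt_zero[of "4 * J"] by (simp add: \<theta>_def divide_simps add_pos_pos)
  moreover have "1 / (1 + exp (- (4 * J))) = 1 - \<theta> / 2"
    using logistic_symmetric[of "4 * J"] calculation by linarith
  ultimately show ?thesis
    using assms theta_bounds by (elim insertE emptyE) (simp_all add: abs_if)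
qed

lemma flip_rate_diff:
  assumes "i < N" "j < N" "i \<noteq> j" and \<sigma>: "\<sigma> \<in> configs N"
  shows "\<bar>flip_rate i (flip {j} \<sigma>) - flip_rate i \<sigma>\<bar>
    \<le> (if i = cyc N j then (1 - \<theta>) / 2 else 0) + (if i = pred_site N j then (1 - \<theta>) / 2 else 0)"
proof -
  have spins: "real_of_int (\<sigma> k) \<in> {-1, 1}" if "k < N" for k
    using spin_cases[OF \<sigma> that] by auto
  note s = spins[OF \<open>i < N\<close>] spins[OF pred_less[OF \<open>i < N\<close>]] spins[OF cyc_less[OF \<open>i < N\<close>]]
  have iff: "i = cyc N j \<longleftrightarrow> pred_site N i = j" "i = pred_site N j \<longleftrightarrow> cyc N i = j"
    using cyc_eq_iff[of j N i] cyc_eq_iff[of i N j] assms by auto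
  have "pred_site N i \<noteq> cyc N i" using neighbours[OF \<open>i < N\<close>] by simp
  consider "pred_site N i = j" | "cyc N i = j" | "pred_site N i \<noteq> j" "cyc N i \<noteq> j" by blast
  then show ?thesis
  proof cases
    case 1
    then show ?thesis
      using flip_rate_influence[OF s(1,2,3)] \<open>i \<noteq> j\<close> \<open>pred_site N i \<noteq> cyc N i\<close>
      by (simp add: flip_rate_def alignment_def flip_def iff)
  next
    case 2
    then show ?thesis
      using flip_rate_influence[OF s(1,3,2)] \<open>i \<noteq> j\<close> \<open>pred_site N i \<noteq> cyc N i\<close>
      by (simp add: flip_rate_def alignment_def flip_def iff add.commute)
  next
    case 3
    then show ?thesis
      using \<open>i \<noteq> j\<close> by (simp add: flip_rate_def alignment_def flip_def iff)
  qed
qed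

text \<open>
  Flipping spin \<open>j\<close> and then resampling spin \<open>i\<close> changes \<open>u\<close>
  in two ways: through spin \<open>j\<close> itself, unless it is the one being resampled, and
  through the conditional law at \<open>i\<close>, if \<open>i\<close> is a neighbour of
  \<open>j\<close>.
\<close>

lemma resample_lipschitz:
  assumes u: "flip_lipschitz D u" and ij: "i < N" "j < N" and \<sigma>: "\<sigma> \<in> configs N"
  shows "\<bar>resample i u (flip {j} \<sigma>) - resample i u \<sigma>\<bar>
    \<le> D * ((if i = j then 0 else 1)
        + ((if i = cyc N j then (1 - \<theta>) / 2 else 0) + (if i = pred_site N j then (1 - \<theta>) / 2 else 0)))"
    (is "_ \<le> D * (_ + ?\<delta>)")
proof -
  have lip: "\<bar>u (flip {k} \<tau>) - u \<tau>\<bar> \<le> D" if "k < N" "\<tau> \<in> configs N" for k \<tau>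
    using u that by (auto simp: flip_lipschitz_def)
  have D: "0 \<le> D" using lip[OF ij(1) \<sigma>] by linarith
  have \<delta>: "0 \<le> ?\<delta>" using theta_bounds by simp
  show ?thesis
  proof (cases "i = j")
    case True
    have "flip_rate i (flip {i} \<sigma>) = 1 - flip_rate i \<sigma>"
      using ij logistic_symmetric[of "2 * J * alignment i \<sigma>"]
      by (simp add: flip_rate_def alignment_flip)
    then have "resample i u (flip {i} \<sigma>) = resample i u \<sigma>"
      unfolding resample_def \<open>flip_rate i (flip {i} \<sigma>) = _\<close> by (simp add: algebra_simps)
    then show ?thesis using True D \<delta> by simp
  next
    case False
    let ?r = "flip_rate i \<sigma>" and ?r' = "flip_rate i (flip {j} \<sigma>)"
    have \<sigma>i: "flip {i} \<sigma> \<in> configs N" using ij \<sigma> by (intro flip_in_configs) auto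
    have split: "resample i u (flip {j} \<sigma>) - resample i u \<sigma>
        = (1 - ?r') * (u (flip {j} \<sigma>) - u \<sigma>)
          + ?r' * (u (flip {j} (flip {i} \<sigma>)) - u (flip {i} \<sigma>))
          + (?r' - ?r) * (u (flip {i} \<sigma>) - u \<sigma>)"
      by (simp add: resample_def flip_commute[of "{j}" "{i}"] algebra_simps)
    have "\<bar>resample i u (flip {j} \<sigma>) - resample i u \<sigma>\<bar> \<le> (1 - ?r') * D + ?r' * D + ?\<delta> * D"
      unfolding split
    proof (intro order_trans[OF abs_triangle_ineq] add_mono)
      show "\<bar>(1 - ?r') * (u (flip {j} \<sigma>) - u \<sigma>)\<bar> \<le> (1 - ?r') * D"
        using flip_rate_bounds(2)[of i "flip {j} \<sigma>"] lip[OF ij(2) \<sigma>]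
        by (simp add: abs_mult mult_left_mono)
      show "\<bar>?r' * (u (flip {j} (flip {i} \<sigma>)) - u (flip {i} \<sigma>))\<bar> \<le> ?r' * D"
        using flip_rate_bounds(1)[of i "flip {j} \<sigma>"] lip[OF ij(2) \<sigma>i]
        by (simp add: abs_mult mult_left_mono)
      show "\<bar>(?r' - ?r) * (u (flip {i} \<sigma>) - u \<sigma>)\<bar> \<le> ?\<delta> * D"
        unfolding abs_mult
        by (rule mult_mono[OF flip_rate_diff[OF ij False \<sigma>] lip[OF ij(1) \<sigma>] \<delta> abs_ge_zero])
    qed
    also have "\<dots> = D * (1 + ?\<delta>)" by (simp only: algebra_simps)
    finally show ?thesis using False by (simp only: if_False)
  qed
qed

text \<open>
  Summing \<open>resample_lipschitz\<close> over \<open>i\<close>: the site \<open>j\<close> gains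
  \<open>1\<close>, its two neighbours lose \<open>1 - \<theta>\<close> together, and the net gain
  is \<open>\<theta>\<close> out of \<open>N\<close>.
\<close>

lemma heat_bath_contraction:
  assumes u: "flip_lipschitz D u"
  shows "flip_lipschitz (D * (1 - \<theta> / real N)) (heat_bath u)"
  unfolding flip_lipschitz_def
proof (intro ballI allI impI)
  fix \<sigma> j assume \<sigma>: "\<sigma> \<in> configs N" and j: "j < N"
  let ?b = "\<lambda>i. (if i = cyc N j then (1 - \<theta>) / 2 else 0) + (if i = pred_site N j then (1 - \<theta>) / 2 else 0)"
  have "heat_bath u (flip {j} \<sigma>) - heat_bath u \<sigma>
      = (\<Sum>i<N. resample i u (flip {j} \<sigma>) - resample i u \<sigma>) / real N"
    by (simp add: heat_bath_def sum_subtractf diff_divide_distrib)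
  then have "\<bar>heat_bath u (flip {j} \<sigma>) - heat_bath u \<sigma>\<bar>
      \<le> (\<Sum>i<N. \<bar>resample i u (flip {j} \<sigma>) - resample i u \<sigma>\<bar>) / real N"
    by (simp add: abs_divide divide_right_mono sum_abs)
  also have "\<dots> \<le> (\<Sum>i<N. D * ((if i = j then 0 else 1) + ?b i)) / real N"
    using u j \<sigma> by (intro divide_right_mono sum_mono resample_lipschitz) simp_all
  also have "(\<Sum>i<N. D * ((if i = j then 0 else 1) + ?b i)) = D * (\<Sum>i<N. (1 - (if i = j then 1 else 0)) + ?b i)"
    unfolding sum_distrib_left by (intro sum.cong refl arg_cong[where f = "(*) D"]) simp
  also have "(\<Sum>i<N. (1 - (if i = j then 1 else 0)) + ?b i) = real N - \<theta>"
    unfolding sum.distrib sum_subtractf using j cyc_less[OF j] pred_less[OF j]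
    by simp
  finally show "\<bar>heat_bath u (flip {j} \<sigma>) - heat_bath u \<sigma>\<bar> \<le> D * (1 - \<theta> / real N)"
    using N_ge_3 by (simp add: field_simps)
qed

text \<open>
  Two configurations are joined by at most \<open>N\<close> flips.
\<close>

lemma flip_lipschitz_oscillation:
  assumes u: "flip_lipschitz D u" and \<sigma>: "\<sigma> \<in> configs N" and \<tau>: "\<tau> \<in> configs N"
  shows "\<bar>u \<tau> - u \<sigma>\<bar> \<le> real N * D"
proof -
  \<comment> \<open>The path that replaces the spins of \<open>\<sigma>\<close> by those of \<open>\<tau>\<close> one after the other.\<close>
  define h where "h k i = (if i < k then \<tau> i else \<sigma> i)" for k i
  have h: "h k \<in> configs N" for k
    using \<sigma> \<tau> by (auto simp: h_def configs_def PiE_iff extensional_def)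
  have "0 < N" using N_ge_3 by simp
  then have "\<bar>u (flip {0} \<sigma>) - u \<sigma>\<bar> \<le> D" using u \<sigma> unfolding flip_lipschitz_def by blast
  then have D: "0 \<le> D" by linarith
  have step: "\<bar>u (h (Suc k)) - u (h k)\<bar> \<le> D" if k: "k < N" for k
  proof (cases "\<tau> k = \<sigma> k")
    case True
    then have "h (Suc k) = h k" by (auto simp: h_def less_Suc_eq)
    then show ?thesis using D by simp
  next
    case False
    then have "\<tau> k = - \<sigma> k"
      using spin_cases[OF \<sigma> k] spin_cases[OF \<tau> k] by auto
    then have "h (Suc k) = flip {k} (h k)" by (auto simp: h_def flip_def less_Suc_eq)
    then show ?thesis using u h k by (auto simp: flip_lipschitz_def)
  qed
  have "h N = \<tau>" using \<sigma> \<tau> by (auto simp: h_def configs_def PiE_iff extensional_def)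
  moreover have "h 0 = \<sigma>" by (auto simp: h_def)
  ultimately have "\<bar>u \<tau> - u \<sigma>\<bar> = \<bar>\<Sum>k<N. u (h (Suc k)) - u (h k)\<bar>"
    by (simp add: sum_lessThan_telescope[of "\<lambda>k. u (h k)"])
  also have "\<dots> \<le> (\<Sum>k<N. \<bar>u (h (Suc k)) - u (h k)\<bar>)" by (rule sum_abs)
  also have "\<dots> \<le> (\<Sum>k<N. D)" by (intro sum_mono step) auto
  finally show ?thesis by simp
qed

lemma centered_lipschitz_bound:
  assumes u: "flip_lipschitz D u" and mean: "E u = 0"
  shows "E (\<lambda>\<sigma>. (u \<sigma>)\<^sup>2) \<le> (real N * D)\<^sup>2"
proof -
  have "\<bar>u \<sigma>\<bar> \<le> real N * D" if \<sigma>: "\<sigma> \<in> configs N" for \<sigma>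
  proof -
    have "u \<sigma> = E (\<lambda>\<tau>. u \<sigma> - u \<tau>)" using mean by simp
    also have "\<bar>\<dots>\<bar> \<le> E (\<lambda>\<tau>. \<bar>u \<sigma> - u \<tau>\<bar>)" by (rule integral_abs_bound)
    also have "\<dots> \<le> E (\<lambda>\<tau>. real N * D)"
      by (intro E_mono flip_lipschitz_oscillation[OF u _ \<sigma>])
    finally show ?thesis by simp
  qed
  then have "E (\<lambda>\<sigma>. (u \<sigma>)\<^sup>2) \<le> E (\<lambda>\<sigma>. (real N * D)\<^sup>2)"
    by (intro E_mono) (metis abs_ge_zero power2_abs power_mono)
  then show ?thesis by simp
qed

text \<open>
  The contraction of the Lipschitz constant makes the iterates decay at rate \<open>1 - \<theta> /
  N\<close>, but with a constant that depends on \<open>u\<close> and \<open>N\<close>. Since the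
  heat bath is symmetric, the mean squares of the iterates form a log-convex sequence, and
  \<open>log_convex_ratio_le\<close> removes the constant.
\<close>

lemma heat_bath_L2_contraction:
  assumes mean: "E u = 0"
  shows "E (\<lambda>\<sigma>. (heat_bath u \<sigma>)\<^sup>2) \<le> (1 - \<theta> / real N)\<^sup>2 * E (\<lambda>\<sigma>. (u \<sigma>)\<^sup>2)"
proof -
  define \<rho> where "\<rho> = 1 - \<theta> / real N"
  define a where "a n = E (\<lambda>\<sigma>. ((heat_bath ^^ n) u \<sigma>)\<^sup>2)" for n
  define D where "D = 2 * (\<Sum>\<sigma>\<in>configs N. \<bar>u \<sigma>\<bar>)"
  have "\<rho> > 0" unfolding \<rho>_def by (rule contraction_factor_pos)
  have bound: "\<bar>u \<sigma>\<bar> \<le> D / 2" if "\<sigma> \<in> configs N" for \<sigma>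
    unfolding D_def using that member_le_sum[of \<sigma> "configs N" "\<lambda>\<sigma>. \<bar>u \<sigma>\<bar>"]
    by (simp add: finite_configs)
  have lip0: "flip_lipschitz D u"
    unfolding flip_lipschitz_def
  proof (intro ballI allI impI)
    fix \<sigma> j assume "\<sigma> \<in> configs N" "j < N"
    then show "\<bar>u (flip {j} \<sigma>) - u \<sigma>\<bar> \<le> D"
      using bound[of \<sigma>] bound[of "flip {j} \<sigma>"] flip_in_configs[of "{j}" N \<sigma>] by auto
  qed
  have lip: "flip_lipschitz (D * \<rho> ^ n) ((heat_bath ^^ n) u)" for n
  proof (induction n)
    case (Suc n)
    show ?case using heat_bath_contraction[OF Suc] by (simp add: \<rho>_def mult_ac)
  qed (simp add: lip0)
  have mean_n: "E ((heat_bath ^^ n) u) = 0" for n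
    by (induction n) (simp_all add: mean E_heat_bath)
  have "a 1 \<le> \<rho>\<^sup>2 * a 0"
  proof (rule log_convex_ratio_le)
    show "0 \<le> a n" for n by (simp add: a_def)
    show "(a (Suc n))\<^sup>2 \<le> a n * a (Suc (Suc n))" for n
    proof -
      have "(a (Suc n))\<^sup>2 = (E (\<lambda>\<sigma>. (heat_bath ^^ n) u \<sigma> * (heat_bath ^^ Suc (Suc n)) u \<sigma>))\<^sup>2"
        unfolding a_def power2_eq_square
        using heat_bath_symmetric[of "(heat_bath ^^ n) u" "(heat_bath ^^ Suc n) u"] by simp
      also have "\<dots> \<le> a n * a (Suc (Suc n))"
        unfolding a_def by (rule expectation_Cauchy_Schwarz[OF finite_gibbs])
      finally show ?thesis .
    qed
    show "a n \<le> (real N * D)\<^sup>2 * (\<rho>\<^sup>2) ^ n" for n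
    proof -
      have "a n \<le> (real N * (D * \<rho> ^ n))\<^sup>2"
        unfolding a_def by (rule centered_lipschitz_bound[OF lip mean_n])
      also have "\<dots> = (real N * D)\<^sup>2 * (\<rho>\<^sup>2) ^ n"
        by (simp add: power_mult_distrib mult_ac flip: power_mult)
      finally show ?thesis .
    qed
    show "0 < \<rho>\<^sup>2" using \<open>\<rho> > 0\<close> by simp
  qed
  then show ?thesis by (simp add: a_def \<rho>_def)
qed

text \<open>
  By \<open>heat_bath_L2_contraction\<close> the heat bath has gap \<open>\<theta> / N\<close>, and
  its Dirichlet form is at most the one of unweighted flips divided by \<open>2 * N\<close>; the
  factors \<open>N\<close> cancel.
\<close>

lemma gibbs_poincare:
  assumes mean: "E u = 0"
  shows "\<theta> * E (\<lambda>\<sigma>. (u \<sigma>)\<^sup>2) \<le> (\<Sum>i<N. E (\<lambda>\<sigma>. (u (flip {i} \<sigma>) - u \<sigma>)\<^sup>2)) / 2"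
proof -
  let ?\<rho> = "1 - \<theta> / real N" and ?b = "E (\<lambda>\<sigma>. (u \<sigma>)\<^sup>2)"
  note \<rho> = contraction_factor_pos
  have b: "?b \<ge> 0" by simp
  have "(E (\<lambda>\<sigma>. u \<sigma> * heat_bath u \<sigma>))\<^sup>2 \<le> ?b * E (\<lambda>\<sigma>. (heat_bath u \<sigma>)\<^sup>2)"
    by (rule expectation_Cauchy_Schwarz[OF finite_gibbs])
  also have "\<dots> \<le> ?b * (?\<rho>\<^sup>2 * ?b)"
    by (rule mult_left_mono[OF heat_bath_L2_contraction[OF mean] b])
  also have "\<dots> = (?\<rho> * ?b)\<^sup>2" by (simp add: power2_eq_square mult_ac)
  finally have le: "E (\<lambda>\<sigma>. u \<sigma> * heat_bath u \<sigma>) \<le> ?\<rho> * ?b"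
    by (rule power2_le_imp_le) (use \<rho> b in simp)
  have "\<theta> / real N * ?b = ?b - ?\<rho> * ?b" by (simp add: left_diff_distrib)
  also have "\<dots> \<le> E (\<lambda>\<sigma>. (u \<sigma> - heat_bath u \<sigma>) * u \<sigma>)"
    using le by (simp add: left_diff_distrib power2_eq_square mult.commute[of "heat_bath u _"])
  also have "\<dots> = (\<Sum>i<N. E (\<lambda>\<sigma>. flip_rate i \<sigma> * (u (flip {i} \<sigma>) - u \<sigma>)\<^sup>2)) / (2 * real N)"
    by (simp add: heat_bath_form power2_eq_square)
  also have "\<dots> \<le> (\<Sum>i<N. E (\<lambda>\<sigma>. (u (flip {i} \<sigma>) - u \<sigma>)\<^sup>2)) / (2 * real N)"
    by (intro divide_right_mono sum_mono E_mono)
       (auto intro!: mult_left_le_one_le flip_rate_bounds)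
  finally have "\<theta> * ?b / real N \<le> (\<Sum>i<N. E (\<lambda>\<sigma>. (u (flip {i} \<sigma>) - u \<sigma>)\<^sup>2)) / 2 / real N"
    by simp
  then show ?thesis
    using N_ge_3 by (subst (asm) divide_le_cancel) auto
qed

end

section \<open>Stationarity and spectral gap of the Wolff dynamics\<close>

definition bonds :: "nat \<Rightarrow> (nat \<Rightarrow> bool) set" where
  "bonds N = PiE_dflt {..<N} False (\<lambda>_. UNIV)"

lemma finite_bonds: "finite (bonds N)"
  by (simp add: bonds_def finite_PiE_dflt)

lemma set_pmf_open_edges: "set_pmf (open_edges J N \<sigma>) \<subseteq> bonds N"
  unfolding open_edges_def bonds_def
  by (rule order_trans[OF set_Pi_pmf_subset]) (auto simp: PiE_dflt_def)

lemma finite_open_edges: "finite (set_pmf (open_edges J N \<sigma>))"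
  using set_pmf_open_edges finite_bonds by (rule finite_subset)

lemma cluster_subset:
  assumes "i < N"
  shows "cluster N \<eta> i \<subseteq> {..<N}"
proof
  fix j assume "j \<in> cluster N \<eta> i"
  then have "(i, j) \<in> {(a, b). \<exists>e<N. \<eta> e \<and> {a, b} = {e, cyc N e}}\<^sup>*"
    by (simp add: cluster_def)
  then show "j \<in> {..<N}"
    by (induction rule: rtrancl_induct) (use assms cyc_less in \<open>auto simp: doubleton_eq_iff\<close>)
qed

lemma open_edge_in_cluster:
  assumes "e < N" "\<eta> e"
  shows "e \<in> cluster N \<eta> i \<longleftrightarrow> cyc N e \<in> cluster N \<eta> i"
proof -
  let ?R = "{(a, b). \<exists>e<N. \<eta> e \<and> {a, b} = {e, cyc N e}}"
  have "(e, cyc N e) \<in> ?R" "(cyc N e, e) \<in> ?R"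
    using assms by auto
  then show ?thesis
    unfolding cluster_def by (auto intro: rtrancl_into_rtrancl)
qed

lemma cluster_isolated:
  assumes "\<And>e. e < N \<Longrightarrow> e = i \<or> cyc N e = i \<Longrightarrow> \<not> \<eta> e"
  shows "cluster N \<eta> i = {i}"
proof -
  have "j = i" if "(i, j) \<in> {(a, b). \<exists>e<N. \<eta> e \<and> {a, b} = {e, cyc N e}}\<^sup>*" for j
    using that
    by (induction rule: rtrancl_induct) (use assms in \<open>auto simp: doubleton_eq_iff\<close>)
  then show ?thesis by (auto simp: cluster_def)
qed

context ising_ring
begin

lemma edge_open_prob_range: "0 \<le> edge_open_prob J N \<sigma> e" "edge_open_prob J N \<sigma> e \<le> 1"
  using J_nonneg by (auto simp: edge_open_prob_def)

text \<open>
  This is the Edwards-Sokal joint weight. Given the set of open edges, the spins enter only through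
  the requirement that open edges join aligned spins: a closed edge weighs \<open>exp (- J)\<close>
  in either case, as \<open>exp J * exp (- 2 * J) = exp (- J)\<close>.
\<close>

lemma gibbs_times_open_edges:
  assumes \<eta>: "\<eta> \<in> bonds N" and \<sigma>: "\<sigma> \<in> configs N"
  shows "gibbs_weight J N \<sigma> * pmf (open_edges J N \<sigma>) \<eta>
    = (\<Prod>e<N. if \<eta> e then if \<sigma> e = \<sigma> (cyc N e) then exp J - exp (- J) else 0 else exp (- J))"
proof -
  have "gibbs_weight J N \<sigma> = (\<Prod>e<N. exp (J * real_of_int (\<sigma> e * \<sigma> (cyc N e))))"
    by (simp add: gibbs_weight_def sum_distrib_left exp_sum)
  moreover have "pmf (open_edges J N \<sigma>) \<eta> = (\<Prod>e<N. pmf (bernoulli_pmf (edge_open_prob J N \<sigma> e)) (\<eta> e))"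
    unfolding open_edges_def using \<eta> by (intro pmf_Pi') (auto simp: bonds_def PiE_dflt_def)
  moreover have "exp (J * real_of_int (\<sigma> e * \<sigma> (cyc N e))) * pmf (bernoulli_pmf (edge_open_prob J N \<sigma> e)) (\<eta> e)
      = (if \<eta> e then if \<sigma> e = \<sigma> (cyc N e) then exp J - exp (- J) else 0 else exp (- J))"
    if e: "e < N" for e
  proof -
    have "exp J * exp (- (2 * J)) = exp (- J)" by (simp flip: exp_add)
    then show ?thesis
      using spin_cases[OF \<sigma> e] spin_cases[OF \<sigma> cyc_less[OF e]] edge_open_prob_range[of \<sigma> e]
      by (auto simp: pmf_bernoulli_True pmf_bernoulli_False edge_open_prob_def algebra_simps)
  qed
  ultimately show ?thesis
    by (simp flip: prod.distrib)
qed

text \<open>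
  An open edge has both or none of its ends in a cluster, so flipping a cluster leaves the alignment
  along open edges unchanged.
\<close>

lemma gibbs_times_open_edges_flip:
  assumes "i < N" and \<eta>: "\<eta> \<in> bonds N" and \<sigma>: "\<sigma> \<in> configs N"
  defines "\<tau> \<equiv> flip (cluster N \<eta> i) \<sigma>"
  shows "pmf (gibbs J N) \<tau> * pmf (open_edges J N \<tau>) \<eta> = pmf (gibbs J N) \<sigma> * pmf (open_edges J N \<sigma>) \<eta>"
proof -
  have \<tau>: "\<tau> \<in> configs N"
    unfolding \<tau>_def by (rule flip_in_configs[OF cluster_subset[OF \<open>i < N\<close>] \<sigma>])
  have "\<tau> e = \<tau> (cyc N e) \<longleftrightarrow> \<sigma> e = \<sigma> (cyc N e)" if "e < N" "\<eta> e" for e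
    using open_edge_in_cluster[of e N \<eta> i] that by (auto simp: \<tau>_def flip_def)
  then have "gibbs_weight J N \<tau> * pmf (open_edges J N \<tau>) \<eta> = gibbs_weight J N \<sigma> * pmf (open_edges J N \<sigma>) \<eta>"
    unfolding gibbs_times_open_edges[OF \<eta> \<sigma>] gibbs_times_open_edges[OF \<eta> \<tau>]
    by (intro prod.cong) auto
  then show ?thesis
    using \<sigma> \<tau> by (simp add: pmf_gibbs)
qed

lemma expectation_open_edges:
  "measure_pmf.expectation (open_edges J N \<sigma>) g = (\<Sum>\<eta>\<in>bonds N. pmf (open_edges J N \<sigma>) \<eta> * g \<eta>)"
  for g :: "_ \<Rightarrow> real"
  using set_pmf_open_edges[of J N \<sigma>] by (subst integral_measure_pmf[OF finite_bonds]) auto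

lemma expectation_wolff_step:
  "measure_pmf.expectation (wolff_step J N \<sigma>) g
    = (\<Sum>i<N. measure_pmf.expectation (open_edges J N \<sigma>) (\<lambda>\<eta>. g (flip (cluster N \<eta> i) \<sigma>))) / real N"
  for g :: "_ \<Rightarrow> real"
proof -
  have "{..<N} \<noteq> {}" using N_ge_3 by (auto simp: lessThan_empty_iff)
  then show ?thesis
    unfolding wolff_step_def
    by (subst pmf_expectation_bind_pmf_of_set)
       (auto simp: finite_open_edges divide_inverse mult.commute simp flip: sum_distrib_left)
qed

text \<open>
  For a fixed set of open edges, flipping the cluster of \<open>i\<close> is an involution of the
  configurations that preserves the joint weight.
\<close>

lemma cluster_flip_invariant:
  assumes i: "i < N"
  shows "E (\<lambda>\<sigma>. measure_pmf.expectation (open_edges J N \<sigma>) (\<lambda>\<eta>. g (flip (cluster N \<eta> i) \<sigma>))) = E g"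
proof -
  let ?W = "\<lambda>\<sigma> \<eta>. pmf (gibbs J N) \<sigma> * pmf (open_edges J N \<sigma>) \<eta>"
  have "E (\<lambda>\<sigma>. measure_pmf.expectation (open_edges J N \<sigma>) (\<lambda>\<eta>. g (flip (cluster N \<eta> i) \<sigma>)))
      = (\<Sum>\<sigma>\<in>configs N. \<Sum>\<eta>\<in>bonds N. ?W \<sigma> \<eta> * g (flip (cluster N \<eta> i) \<sigma>))"
    by (simp add: E_sum expectation_open_edges sum_distrib_left mult.assoc)
  also have "\<dots> = (\<Sum>\<eta>\<in>bonds N. \<Sum>\<sigma>\<in>configs N. ?W \<sigma> \<eta> * g (flip (cluster N \<eta> i) \<sigma>))"
    by (rule sum.swap)
  also have "\<dots> = (\<Sum>\<eta>\<in>bonds N. \<Sum>\<sigma>\<in>configs N. ?W (flip (cluster N \<eta> i) \<sigma>) \<eta> * g (flip (cluster N \<eta> i) \<sigma>))"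
    using i by (intro sum.cong) (simp_all add: gibbs_times_open_edges_flip)
  also have "\<dots> = (\<Sum>\<eta>\<in>bonds N. \<Sum>\<sigma>\<in>configs N. ?W \<sigma> \<eta> * g \<sigma>)"
    by (intro sum.cong[OF refl] sum.reindex_bij_betw[OF bij_flip[OF cluster_subset[OF i]]])
  also have "\<dots> = (\<Sum>\<sigma>\<in>configs N. \<Sum>\<eta>\<in>bonds N. ?W \<sigma> \<eta> * g \<sigma>)"
    by (rule sum.swap)
  also have "\<dots> = (\<Sum>\<sigma>\<in>configs N. pmf (gibbs J N) \<sigma> * (\<Sum>\<eta>\<in>bonds N. pmf (open_edges J N \<sigma>) \<eta>) * g \<sigma>)"
    by (simp add: sum_distrib_left sum_distrib_right)
  also have "\<dots> = E g"
    by (simp add: E_sum sum_pmf_eq_1 finite_bonds set_pmf_open_edges)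
  finally show ?thesis .
qed

lemma wolff_stationary: "bind_pmf (gibbs J N) (wolff_step J N) = gibbs J N"
proof (rule pmf_eqI)
  fix x
  have ind: "pmf q x = measure_pmf.expectation q (indicator {x} :: _ \<Rightarrow> real)" for q :: "(nat \<Rightarrow> int) pmf"
    by (simp add: measure_pmf_single)
  have "pmf (bind_pmf (gibbs J N) (wolff_step J N)) x
      = E (\<lambda>\<sigma>. measure_pmf.expectation (wolff_step J N \<sigma>) (indicator {x} :: _ \<Rightarrow> real))"
    unfolding pmf_bind by (simp only: ind)
  also have "\<dots> = (\<Sum>i<N. E (indicator {x})) / real N"
    unfolding expectation_wolff_step by (simp add: cluster_flip_invariant del: Bochner_Integration.integral_indicator)
  also have "\<dots> = E (indicator {x})" using N_ge_3 by simp
  finally show "pmf (bind_pmf (gibbs J N) (wolff_step J N)) x = pmf (gibbs J N) x"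
    by (simp only: ind)
qed

sublocale wolff: finite_stationary_chain "gibbs J N" "wolff_step J N"
  by unfold_locales (rule finite_gibbs, rule wolff_stationary)

text \<open>
  The cluster of \<open>i\<close> is a single site as soon as the two edges at \<open>i\<close> are
  closed. They are closed independently, each with probability at least \<open>exp (- 2 *
  J)\<close>.
\<close>

lemma prob_isolated:
  assumes i: "i < N"
  shows "exp (- 4 * J) \<le> measure_pmf.prob (open_edges J N \<sigma>) {\<eta>. cluster N \<eta> i = {i}}"
proof -
  let ?c = "exp (- 2 * J)"
  define B where "B e = (if e = i \<or> e = pred_site N i then {False} else UNIV)" for e
  have "exp (- 4 * J) = ?c * ?c" by (simp flip: exp_add)
  also have "\<dots> = (\<Prod>e<N. (if e = i then ?c else 1) * (if e = pred_site N i then ?c else 1))"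
    using i pred_less[OF i] by (simp add: prod.distrib)
  also have "\<dots> \<le> (\<Prod>e<N. measure_pmf.prob (bernoulli_pmf (edge_open_prob J N \<sigma> e)) (B e))"
  proof (rule prod_mono, safe)
    fix e
    have "?c \<le> 1 - edge_open_prob J N \<sigma> e"
      using J_nonneg by (auto simp: edge_open_prob_def)
    then have "?c \<le> measure_pmf.prob (bernoulli_pmf (edge_open_prob J N \<sigma> e)) {False}"
      using edge_open_prob_range[of \<sigma> e] by (simp add: measure_pmf_single)
    then show "(if e = i then ?c else 1) * (if e = pred_site N i then ?c else 1)
        \<le> measure_pmf.prob (bernoulli_pmf (edge_open_prob J N \<sigma> e)) (B e)"
      using neighbours[OF i] by (auto simp: B_def)
  qed auto
  also have "\<dots> = measure_pmf.prob (open_edges J N \<sigma>) (PiE_dflt {..<N} False B)"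
    unfolding open_edges_def by (simp add: measure_Pi_pmf_PiE_dflt)
  also have "\<dots> \<le> measure_pmf.prob (open_edges J N \<sigma>) {\<eta>. cluster N \<eta> i = {i}}"
  proof (intro measure_pmf.finite_measure_mono subsetI CollectI cluster_isolated)
    fix \<eta> e assume "\<eta> \<in> PiE_dflt {..<N} False B" and e: "e < N" "e = i \<or> cyc N e = i"
    then have "\<eta> e \<in> B e" by (simp add: PiE_dflt_def)
    moreover have "e = i \<or> e = pred_site N i" using e cyc_eq_iff[OF \<open>e < N\<close> i] by simp
    ultimately show "\<not> \<eta> e" by (auto simp: B_def)
  qed simp
  finally show ?thesis .
qed

text \<open>
  Only the steps that flip a single site are kept in the Dirichlet form;
  \<open>gibbs_poincare\<close> shows that they suffice.
\<close>

lemma wolff_spectral_gap: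
  assumes mean: "E u = 0"
  shows "\<theta> * exp (- 4 * J) / real N * E (\<lambda>\<sigma>. (u \<sigma>)\<^sup>2) \<le> E (\<lambda>\<sigma>. u \<sigma> * (u \<sigma> - wolff.P u \<sigma>))"
proof -
  let ?D = "\<lambda>i \<sigma>. (u (flip {i} \<sigma>) - u \<sigma>)\<^sup>2"
  have single: "exp (- 4 * J) * ?D i \<sigma>
      \<le> measure_pmf.expectation (open_edges J N \<sigma>) (\<lambda>\<eta>. (u (flip (cluster N \<eta> i) \<sigma>) - u \<sigma>)\<^sup>2)"
    if i: "i < N" for i \<sigma>
  proof -
    let ?A = "{\<eta>. cluster N \<eta> i = {i}}"
    have "exp (- 4 * J) * ?D i \<sigma> \<le> measure_pmf.prob (open_edges J N \<sigma>) ?A * ?D i \<sigma>"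
      by (intro mult_right_mono prob_isolated i) simp
    also have "\<dots> = measure_pmf.expectation (open_edges J N \<sigma>) (\<lambda>\<eta>. indicator ?A \<eta> * ?D i \<sigma>)"
      by simp
    also have "\<dots> \<le> measure_pmf.expectation (open_edges J N \<sigma>) (\<lambda>\<eta>. (u (flip (cluster N \<eta> i) \<sigma>) - u \<sigma>)\<^sup>2)"
      by (intro integral_mono integrable_measure_pmf_finite finite_open_edges)
         (auto simp: indicator_def)
    finally show ?thesis .
  qed
  have "\<theta> * exp (- 4 * J) / real N * E (\<lambda>\<sigma>. (u \<sigma>)\<^sup>2) = exp (- 4 * J) / real N * (\<theta> * E (\<lambda>\<sigma>. (u \<sigma>)\<^sup>2))"
    by simp
  also have "\<dots> \<le> exp (- 4 * J) / real N * ((\<Sum>i<N. E (?D i)) / 2)"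
    by (intro mult_left_mono gibbs_poincare mean) simp
  also have "\<dots> = E (\<lambda>\<sigma>. (\<Sum>i<N. exp (- 4 * J) * ?D i \<sigma>) / real N) / 2"
    by (simp add: sum_distrib_left sum_divide_distrib)
  also have "\<dots> \<le> E (\<lambda>\<sigma>. measure_pmf.expectation (wolff_step J N \<sigma>) (\<lambda>\<tau>. (u \<tau> - u \<sigma>)\<^sup>2)) / 2"
    unfolding expectation_wolff_step
    by (intro divide_right_mono E_mono sum_mono single) auto
  also have "\<dots> = E (\<lambda>\<sigma>. u \<sigma> * (u \<sigma> - wolff.P u \<sigma>))"
    by (rule wolff.dirichlet_form[symmetric])
  finally show ?thesis .
qed

end

section \<open>Spin correlations\<close>

context ising_ring
begin

definition corr :: "nat \<Rightarrow> nat \<Rightarrow> real" where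
  "corr i j = E (\<lambda>\<sigma>. real_of_int (\<sigma> i * \<sigma> j))"

text \<open>
  The Gibbs measure is invariant under the flip of all spins.
\<close>

lemma E_spin:
  assumes "j < N"
  shows "E (\<lambda>\<sigma>. real_of_int (\<sigma> j)) = 0"
proof -
  let ?F = "flip {..<N}"
  have w: "gibbs_weight J N (?F \<sigma>) = gibbs_weight J N \<sigma>" for \<sigma>
    by (simp add: gibbs_weight_def flip_def cyc_less)
  have "E (\<lambda>\<sigma>. real_of_int (\<sigma> j)) = (\<Sum>\<sigma>\<in>configs N. pmf (gibbs J N) (?F \<sigma>) * real_of_int (?F \<sigma> j))"
    unfolding E_sum by (rule sum.reindex_bij_betw[symmetric]) (rule bij_flip[OF order_refl])
  also have "\<dots> = (\<Sum>\<sigma>\<in>configs N. - (pmf (gibbs J N) \<sigma> * real_of_int (\<sigma> j)))"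
    using assms flip_in_configs[of "{..<N}" N]
    by (intro sum.cong) (auto simp: pmf_gibbs w flip_def)
  also have "\<dots> = - E (\<lambda>\<sigma>. real_of_int (\<sigma> j))"
    by (simp add: E_sum sum_negf)
  finally show ?thesis by simp
qed

text \<open>
  With the signs of the row as coefficients, the row sum of \<open>\<bar>corr i j\<bar>\<close> is
  the covariance of spin \<open>i\<close> with a signed sum \<open>g\<close> of all spins. Each flip
  changes \<open>g\<close> by at most \<open>2\<close>, so by the Poincare inequality its variance
  is of order \<open>N\<close>. Exponential decay of correlations would make the row sum bounded;
  the order \<open>sqrt N\<close> is enough here, since the row of the covariance matrix carries a
  factor \<open>1 / N\<close>.
\<close>

lemma corr_row_sum:
  assumes i: "i < N"
  shows "(\<Sum>j<N. \<bar>corr i j\<bar>)\<^sup>2 \<le> 2 * real N / \<theta>"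
proof -
  let ?s = "\<lambda>j. sgn (corr i j)"
  define g where "g \<sigma> = (\<Sum>j<N. ?s j * real_of_int (\<sigma> j))" for \<sigma>
  have "E g = 0"
    unfolding g_def by (simp add: E_spin)
  have "real_of_int (\<sigma> i) * g \<sigma> = (\<Sum>j<N. ?s j * real_of_int (\<sigma> i * \<sigma> j))" for \<sigma>
    by (simp add: g_def sum_distrib_left mult.left_commute)
  then have "E (\<lambda>\<sigma>. real_of_int (\<sigma> i) * g \<sigma>) = (\<Sum>j<N. ?s j * E (\<lambda>\<sigma>. real_of_int (\<sigma> i * \<sigma> j)))"
    by (simp del: of_int_mult)
  then have pairing: "(\<Sum>j<N. \<bar>corr i j\<bar>) = E (\<lambda>\<sigma>. real_of_int (\<sigma> i) * g \<sigma>)"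
    unfolding corr_def[symmetric] by (simp only: abs_sgn mult.commute)
  have "(\<Sum>j<N. \<bar>corr i j\<bar>)\<^sup>2 \<le> E (\<lambda>\<sigma>. (real_of_int (\<sigma> i))\<^sup>2) * E (\<lambda>\<sigma>. (g \<sigma>)\<^sup>2)"
    unfolding pairing by (rule expectation_Cauchy_Schwarz[OF finite_gibbs])
  also have "E (\<lambda>\<sigma>. (real_of_int (\<sigma> i))\<^sup>2) = E (\<lambda>_. 1)"
    using i by (intro E_cong) (auto dest: spin_cases simp: power2_eq_square)
  finally have *: "(\<Sum>j<N. \<bar>corr i j\<bar>)\<^sup>2 \<le> E (\<lambda>\<sigma>. (g \<sigma>)\<^sup>2)" by simp
  have flip_g: "(g (flip {k} \<sigma>) - g \<sigma>)\<^sup>2 \<le> 4" if k: "k < N" and \<sigma>: "\<sigma> \<in> configs N" for k \<sigma>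
  proof -
    have "g (flip {k} \<sigma>) - g \<sigma> = (\<Sum>j<N. if j = k then - 2 * ?s k * real_of_int (\<sigma> k) else 0)"
      unfolding g_def sum_subtractf[symmetric] by (intro sum.cong) (auto simp: flip_def)
    also have "\<dots> = - 2 * ?s k * real_of_int (\<sigma> k)" using k by simp
    finally show ?thesis
      using spin_cases[OF \<sigma> k] by (auto simp: power_mult_distrib sgn_real_def)
  qed
  have "\<theta> * E (\<lambda>\<sigma>. (g \<sigma>)\<^sup>2) \<le> (\<Sum>k<N. E (\<lambda>\<sigma>. (g (flip {k} \<sigma>) - g \<sigma>)\<^sup>2)) / 2"
    by (rule gibbs_poincare[OF \<open>E g = 0\<close>])
  also have "\<dots> \<le> (\<Sum>k<N. E (\<lambda>\<sigma>. 4)) / 2"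
    by (intro divide_right_mono sum_mono E_mono flip_g) auto
  finally have "E (\<lambda>\<sigma>. (g \<sigma>)\<^sup>2) \<le> 2 * real N / \<theta>"
    using theta_bounds by (simp add: field_simps)
  with * show ?thesis by linarith
qed

end

section \<open>Matrix norms\<close>

text \<open>
  Read the eigenvalue equation at an entry of the eigenvector of maximal modulus.
\<close>

lemma spectral_radius_le_row_sum_norm:
  assumes A: "A \<in> carrier_mat n n" and n: "0 < n"
  shows "0 \<le> spectral_radius (map_mat complex_of_real A)"
    and "spectral_radius (map_mat complex_of_real A) \<le> row_sum_norm A"
proof -
  let ?B = "map_mat complex_of_real A"
  have B: "?B \<in> carrier_mat n n" using A by simp
  from spectral_radius_mem_max(1)[OF B n] obtain k
    where k: "eigenvalue ?B k" and \<rho>: "spectral_radius ?B = norm k"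
    by (auto simp: spectrum_def)
  show "0 \<le> spectral_radius ?B" by (simp add: \<rho>)
  from k obtain v where v: "v \<in> carrier_vec n" "v \<noteq> 0\<^sub>v n" "?B *\<^sub>v v = k \<cdot>\<^sub>v v"
    using B unfolding eigenvalue_def eigenvector_def by auto
  define m where "m = Max ((\<lambda>i. norm (vec_index v i)) ` {..<n})"
  have le_m: "norm (vec_index v i) \<le> m" if "i < n" for i
    unfolding m_def using that by (intro Max_ge) auto
  have "m \<in> (\<lambda>i. norm (vec_index v i)) ` {..<n}"
    unfolding m_def using n by (intro Max_in) auto
  then obtain i where i: "i < n" "m = norm (vec_index v i)" by auto
  have "0 < m"
  proof -
    obtain j where "j < n" "vec_index v j \<noteq> 0" using v(1,2) by (metis eq_vecI carrier_vecD index_zero_vec)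
    then show ?thesis using le_m[of j] by (smt (verit) zero_less_norm_iff)
  qed
  have "k * vec_index v i = (\<Sum>j<n. complex_of_real (A $$ (i, j)) * vec_index v j)"
    using arg_cong[OF v(3), of "\<lambda>w. vec_index w i"] v(1) A i(1)
    by (simp add: scalar_prod_def lessThan_atLeast0)
  then have "norm k * m \<le> (\<Sum>j<n. norm (complex_of_real (A $$ (i, j)) * vec_index v j))"
    unfolding i(2) norm_mult[symmetric] by (simp only: norm_sum)
  also have "\<dots> \<le> (\<Sum>j<n. \<bar>A $$ (i, j)\<bar> * m)"
    by (intro sum_mono) (simp add: norm_mult mult_left_mono le_m)
  also have "\<dots> = (\<Sum>j<dim_col A. \<bar>A $$ (i, j)\<bar>) * m"
    using A by (simp add: sum_distrib_right)
  also have "\<dots> \<le> row_sum_norm A * m"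
    using A i(1) \<open>0 < m\<close> unfolding row_sum_norm_def by (intro mult_right_mono Max_ge) auto
  finally show "spectral_radius ?B \<le> row_sum_norm A"
    using \<open>0 < m\<close> by (simp add: \<rho>)
qed

lemma row_sum_norm_square_le:
  assumes A: "A \<in> carrier_mat n n" and n: "0 < n"
    and C: "\<And>i. i < n \<Longrightarrow> (\<Sum>j<n. \<bar>A $$ (i, j)\<bar>)\<^sup>2 \<le> C"
  shows "(row_sum_norm A)\<^sup>2 \<le> C"
proof -
  have "row_sum_norm A \<in> (\<lambda>i. \<Sum>j<dim_col A. \<bar>A $$ (i, j)\<bar>) ` {..<dim_row A}"
    unfolding row_sum_norm_def using A n by (intro Max_in) (auto simp: lessThan_empty_iff)
  then obtain i where i: "i < n" "row_sum_norm A = (\<Sum>j<n. \<bar>A $$ (i, j)\<bar>)"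
    using A by auto
  then show ?thesis using C[OF i(1)] by simp
qed

section \<open>The sample covariance matrix\<close>

context ising_ring
begin

definition centred_corr :: "nat \<Rightarrow> nat \<Rightarrow> (nat \<Rightarrow> int) \<Rightarrow> real" where
  "centred_corr i j \<sigma> = real_of_int (\<sigma> i * \<sigma> j) - corr i j"

lemma E_centred_corr: "E (centred_corr i j) = 0"
  unfolding centred_corr_def[abs_def] corr_def by (simp del: of_int_mult)

lemma E_centred_corr_square:
  assumes "i < N" "j < N"
  shows "E (\<lambda>\<sigma>. (centred_corr i j \<sigma>)\<^sup>2) \<le> 1"
proof -
  have "E (\<lambda>\<sigma>. (centred_corr i j \<sigma>)\<^sup>2)
      = E (\<lambda>\<sigma>. (real_of_int (\<sigma> i * \<sigma> j))\<^sup>2 - 2 * corr i j * real_of_int (\<sigma> i * \<sigma> j) + (corr i j)\<^sup>2)"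
    by (simp add: centred_corr_def power2_diff algebra_simps del: of_int_mult)
  also have "\<dots> = E (\<lambda>\<sigma>. (real_of_int (\<sigma> i * \<sigma> j))\<^sup>2) - (corr i j)\<^sup>2"
    by (simp add: power2_eq_square flip: corr_def del: of_int_mult)
  also have "E (\<lambda>\<sigma>. (real_of_int (\<sigma> i * \<sigma> j))\<^sup>2) = E (\<lambda>_. 1)"
  proof (rule E_cong)
    fix \<sigma> assume "\<sigma> \<in> configs N"
    from spin_cases[OF this assms(1)] spin_cases[OF this assms(2)]
    show "(real_of_int (\<sigma> i * \<sigma> j))\<^sup>2 = 1" by (elim disjE) simp_all
  qed
  finally show ?thesis by simp
qed

text \<open>
  The bound does not depend on \<open>i\<close>, so it carries over to the maximum over the rows.
  Replacing that maximum of the fluctuation part by the sum over the rows costs a factor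
  \<open>N\<close>.
\<close>

lemma row_sum_square_decomposition:
  assumes M: "0 < M" and i: "i < N"
  shows "(\<Sum>j<N. \<bar>sample_cov N M \<omega> $$ (i, j)\<bar>)\<^sup>2
    \<le> 4 / (\<theta> * real N) + 2 / ((real M)\<^sup>2 * real N) * (\<Sum>i<N. \<Sum>j<N. (\<Sum>k<M. centred_corr i j (\<omega> k))\<^sup>2)"
proof -
  define T where "T i j = (\<Sum>k<M. centred_corr i j (\<omega> k))" for i j
  define a where "a = (\<Sum>j<N. \<bar>corr i j\<bar>) / real N"
  define b where "b = (\<Sum>j<N. \<bar>T i j\<bar>) / (real M * real N)"
  have N: "0 < N" using N_ge_3 by simp
  have entry: "\<bar>sample_cov N M \<omega> $$ (i, j)\<bar> \<le> \<bar>corr i j\<bar> / real N + \<bar>T i j\<bar> / (real M * real N)"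
    if "j < N" for j
  proof -
    have "T i j = (\<Sum>k<M. real_of_int (\<omega> k i * \<omega> k j)) - real M * corr i j"
      by (simp add: T_def centred_corr_def sum_subtractf del: of_int_mult)
    then have "sample_cov N M \<omega> $$ (i, j) = corr i j / real N + T i j / (real M * real N)"
      using i that M N by (simp add: sample_cov_def field_simps del: of_int_mult)
    then show ?thesis
      using abs_triangle_ineq[of "corr i j / real N" "T i j / (real M * real N)"]
      by (simp add: abs_mult)
  qed
  have "(\<Sum>j<N. \<bar>sample_cov N M \<omega> $$ (i, j)\<bar>) \<le> (\<Sum>j<N. \<bar>corr i j\<bar> / real N + \<bar>T i j\<bar> / (real M * real N))"
    by (intro sum_mono entry) simp
  also have "\<dots> = a + b"
    by (simp add: a_def b_def sum.distrib sum_divide_distrib)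
  finally have "(\<Sum>j<N. \<bar>sample_cov N M \<omega> $$ (i, j)\<bar>)\<^sup>2 \<le> (a + b)\<^sup>2"
    by (intro power_mono) (auto intro: sum_nonneg)
  also have "\<dots> \<le> 2 * a\<^sup>2 + 2 * b\<^sup>2"
    using sum_squares_bound[of a b] by (simp add: power2_sum)
  also have "a\<^sup>2 \<le> 2 / (\<theta> * real N)"
  proof -
    have "a\<^sup>2 \<le> (2 * real N / \<theta>) / (real N)\<^sup>2"
      unfolding a_def power_divide by (intro divide_right_mono corr_row_sum i) simp
    then show ?thesis using N by (simp add: power2_eq_square field_simps)
  qed
  also have "b\<^sup>2 \<le> 1 / ((real M)\<^sup>2 * real N) * (\<Sum>i<N. \<Sum>j<N. (T i j)\<^sup>2)"
  proof -
    have "(\<Sum>j<N. \<bar>T i j\<bar>)\<^sup>2 \<le> (\<Sum>j<N. \<bar>T i j\<bar>\<^sup>2) * real (card {..<N})"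
      by (rule sum_squared_le_sum_of_squares)
    also have "\<dots> = (\<Sum>j<N. (T i j)\<^sup>2) * real N" by simp
    also have "\<dots> \<le> (\<Sum>i<N. \<Sum>j<N. (T i j)\<^sup>2) * real N"
      using i by (intro mult_right_mono member_le_sum[where f = "\<lambda>i. \<Sum>j<N. (T i j)\<^sup>2"]) (auto intro: sum_nonneg)
    finally have "b\<^sup>2 \<le> ((\<Sum>i<N. \<Sum>j<N. (T i j)\<^sup>2) * real N) / (real M * real N)\<^sup>2"
      unfolding b_def power_divide by (intro divide_right_mono) auto
    then show ?thesis using N by (simp add: power2_eq_square field_simps)
  qed
  finally show ?thesis
    by (simp add: T_def)
qed

text \<open>
  The \<open>N\<^sup>2\<close> terms \<open>(T i j)\<^sup>2\<close> have expectation at most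
  \<open>4 * M / \<gamma>\<close> with \<open>\<gamma> = \<theta> * exp (- 4 * J) / N\<close>, and
  the prefactor is \<open>2 / (M\<^sup>2 * N)\<close>; this is where \<open>N\<^sup>2 / M\<close>
  comes from.
\<close>

lemma expected_row_sum_norm_square:
  assumes M: "0 < M"
  shows "integrable (wolff_law J N) (\<lambda>\<omega>. (row_sum_norm (sample_cov N M \<omega>))\<^sup>2)"
    and "(\<integral>\<omega>. (row_sum_norm (sample_cov N M \<omega>))\<^sup>2 \<partial>wolff_law J N)
      \<le> 4 / (\<theta> * real N) + 8 / (\<theta> * exp (- 4 * J)) * (real N ^ 2 / real M)"
proof -
  interpret law: prob_space "wolff_law J N"
    unfolding wolff_law_def by (rule wolff.prob_space_L)
  let ?\<gamma> = "\<theta> * exp (- 4 * J) / real N"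
  let ?T = "\<lambda>i j \<omega>. (\<Sum>k<M. centred_corr i j (\<omega> k))\<^sup>2"
  let ?F = "\<lambda>\<omega>. 4 / (\<theta> * real N) + 2 / ((real M)\<^sup>2 * real N) * (\<Sum>i<N. \<Sum>j<N. ?T i j \<omega>)"
  have N: "0 < N" using N_ge_3 by simp
  have \<gamma>: "0 < ?\<gamma>" using N theta_bounds by simp
  note moment = wolff.additive_functional_second_moment[OF wolff_spectral_gap \<gamma> E_centred_corr,
      folded wolff_law_def]
  have T: "integrable (wolff_law J N) (?T i j)" for i j
    by (rule moment(1))
  have ET: "(\<integral>\<omega>. ?T i j \<omega> \<partial>wolff_law J N) \<le> real M * (4 / ?\<gamma>)" if "i < N" "j < N" for i j
  proof -
    have "(\<integral>\<omega>. ?T i j \<omega> \<partial>wolff_law J N) \<le> real M * (4 * E (\<lambda>\<sigma>. (centred_corr i j \<sigma>)\<^sup>2) / ?\<gamma>)"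
      by (rule moment(2))
    also have "\<dots> \<le> real M * (4 * 1 / ?\<gamma>)"
      using \<gamma> that by (intro mult_left_mono divide_right_mono E_centred_corr_square) auto
    finally show ?thesis by simp
  qed
  have F: "integrable (wolff_law J N) ?F"
    by (intro Bochner_Integration.integrable_add integrable_mult_right
        Bochner_Integration.integrable_sum T) simp
  have le: "(row_sum_norm (sample_cov N M \<omega>))\<^sup>2 \<le> ?F \<omega>" for \<omega>
  proof (rule row_sum_norm_square_le)
    show "sample_cov N M \<omega> \<in> carrier_mat N N" by (simp add: sample_cov_def)
  qed (use N row_sum_square_decomposition[OF M] in auto)
  then have "norm ((row_sum_norm (sample_cov N M \<omega>))\<^sup>2) \<le> norm (?F \<omega>)" for \<omega>
    using le[of \<omega>] unfolding real_norm_def by (simp only: abs_power2 order_trans[OF _ abs_ge_self])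
  then show int: "integrable (wolff_law J N) (\<lambda>\<omega>. (row_sum_norm (sample_cov N M \<omega>))\<^sup>2)"
    by (intro Bochner_Integration.integrable_bound[OF F] AE_I2
        measurable_sample_cov[where f = "\<lambda>A. (row_sum_norm A)\<^sup>2"])
  have "(\<integral>\<omega>. (row_sum_norm (sample_cov N M \<omega>))\<^sup>2 \<partial>wolff_law J N) \<le> (\<integral>\<omega>. ?F \<omega> \<partial>wolff_law J N)"
    by (intro integral_mono int F le)
  also have "\<dots> = 4 / (\<theta> * real N)
      + 2 / ((real M)\<^sup>2 * real N) * (\<Sum>i<N. \<Sum>j<N. \<integral>\<omega>. ?T i j \<omega> \<partial>wolff_law J N)"
    using T by (simp add: law.prob_space)
  also have "\<dots> \<le> 4 / (\<theta> * real N) + 2 / ((real M)\<^sup>2 * real N) * (\<Sum>i<N. \<Sum>j<N. real M * (4 / ?\<gamma>))"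
    by (intro add_left_mono mult_left_mono sum_mono ET) auto
  also have "\<dots> = 4 / (\<theta> * real N) + 8 / (\<theta> * exp (- 4 * J)) * (real N ^ 2 / real M)"
    using M N by (simp add: power2_eq_square)
  finally show "(\<integral>\<omega>. (row_sum_norm (sample_cov N M \<omega>))\<^sup>2 \<partial>wolff_law J N)
      \<le> 4 / (\<theta> * real N) + 8 / (\<theta> * exp (- 4 * J)) * (real N ^ 2 / real M)" .
qed

lemma expected_spectral_radius:
  assumes M: "0 < M"
  shows "0 \<le> (\<integral>\<omega>. spectral_radius (map_mat complex_of_real (sample_cov N M \<omega>)) \<partial>wolff_law J N)"
    and "(\<integral>\<omega>. spectral_radius (map_mat complex_of_real (sample_cov N M \<omega>)) \<partial>wolff_law J N)\<^sup>2
      \<le> (\<integral>\<omega>. (row_sum_norm (sample_cov N M \<omega>))\<^sup>2 \<partial>wolff_law J N)"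
proof -
  interpret law: prob_space "wolff_law J N"
    unfolding wolff_law_def by (rule wolff.prob_space_L)
  let ?r = "\<lambda>\<omega>. spectral_radius (map_mat complex_of_real (sample_cov N M \<omega>))"
  let ?n = "\<lambda>\<omega>. row_sum_norm (sample_cov N M \<omega>)"
  have N: "0 < N" using N_ge_3 by simp
  have bounds: "0 \<le> ?r \<omega>" "?r \<omega> \<le> ?n \<omega>" for \<omega>
    using spectral_radius_le_row_sum_norm[of "sample_cov N M \<omega>" N] N
    by (auto simp: sample_cov_def)
  have meas: "?r \<in> borel_measurable (wolff_law J N)"
    by (rule measurable_sample_cov[where f = "\<lambda>A. spectral_radius (map_mat complex_of_real A)"])
  have sq: "(?r \<omega>)\<^sup>2 \<le> (?n \<omega>)\<^sup>2" for \<omega>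
    by (intro power_mono bounds)
  have int_sq: "integrable (wolff_law J N) (\<lambda>\<omega>. (?r \<omega>)\<^sup>2)"
    by (rule Bochner_Integration.integrable_bound[OF expected_row_sum_norm_square(1)[OF M]])
       (use meas sq in auto)
  then have int: "integrable (wolff_law J N) ?r"
    by (rule law.square_integrable_imp_integrable[OF meas])
  show "0 \<le> (\<integral>\<omega>. ?r \<omega> \<partial>wolff_law J N)"
    by (rule Bochner_Integration.integral_nonneg) (rule bounds)
  have "0 \<le> law.variance ?r" by (rule law.variance_positive)
  then have "(\<integral>\<omega>. ?r \<omega> \<partial>wolff_law J N)\<^sup>2 \<le> (\<integral>\<omega>. (?r \<omega>)\<^sup>2 \<partial>wolff_law J N)"
    by (simp add: law.variance_eq[OF int int_sq])
  also have "\<dots> \<le> (\<integral>\<omega>. (?n \<omega>)\<^sup>2 \<partial>wolff_law J N)"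
    by (intro integral_mono int_sq expected_row_sum_norm_square(1)[OF M] sq)
  finally show "(\<integral>\<omega>. ?r \<omega> \<partial>wolff_law J N)\<^sup>2 \<le> (\<integral>\<omega>. (?n \<omega>)\<^sup>2 \<partial>wolff_law J N)" .
qed

end

theorem theorem4p6:
  fixes J :: real and N :: "nat \<Rightarrow> nat"
  assumes "0 \<le> J"
    and "filterlim N at_top sequentially"
    and "(\<lambda>M. real (N M) / sqrt (real M)) \<longlonglongrightarrow> 0"
  shows "(\<lambda>M. \<integral>\<omega>. (row_sum_norm (sample_cov (N M) M \<omega>))\<^sup>2 \<partial>wolff_law J (N M)) \<longlonglongrightarrow> 0 \<and>
         (\<lambda>M. \<integral>\<omega>. spectral_radius (map_mat complex_of_real (sample_cov (N M) M \<omega>)) \<partial>wolff_law J (N M)) \<longlonglongrightarrow> 0"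
proof -
  define c where "c = 2 / (1 + exp (4 * J))"
  define bound where "bound M = 4 / c * (1 / real (N M)) + 8 / (c * exp (- 4 * J)) * (real (N M) / sqrt (real M))\<^sup>2" for M
  let ?n = "\<lambda>M. \<integral>\<omega>. (row_sum_norm (sample_cov (N M) M \<omega>))\<^sup>2 \<partial>wolff_law J (N M)"
  let ?r = "\<lambda>M. \<integral>\<omega>. spectral_radius (map_mat complex_of_real (sample_cov (N M) M \<omega>)) \<partial>wolff_law J (N M)"
  have "filterlim (\<lambda>M. real (N M)) at_top sequentially"
    by (rule filterlim_compose[OF filterlim_real_sequentially assms(2)])
  then have "(\<lambda>M. 1 / real (N M)) \<longlonglongrightarrow> 0"
    by (intro tendsto_divide_0[OF tendsto_const] filterlim_at_top_imp_at_infinity)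
  then have "bound \<longlonglongrightarrow> 4 / c * 0 + 8 / (c * exp (- 4 * J)) * 0\<^sup>2"
    unfolding bound_def by (intro tendsto_intros assms(3))
  then have bound: "bound \<longlonglongrightarrow> 0" by simp
  have ev: "\<forall>\<^sub>F M in sequentially. 3 \<le> N M \<and> 0 < M"
    using filterlim_at_top[THEN iffD1, OF assms(2)] eventually_gt_at_top[of 0] by (auto intro: eventually_conj)
  have *: "?n M \<le> bound M" "0 \<le> ?r M" "(?r M)\<^sup>2 \<le> ?n M" if "3 \<le> N M \<and> 0 < M" for M
  proof -
    interpret ising_ring J "N M"
      using that assms(1) by unfold_locales auto
    show "?n M \<le> bound M"
      using expected_row_sum_norm_square(2)[of M] that
      by (simp add: bound_def c_def \<theta>_def power_divide)
    show "0 \<le> ?r M" "(?r M)\<^sup>2 \<le> ?n M"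
      using expected_spectral_radius[of M] that by auto
  qed
  have n: "?n \<longlonglongrightarrow> 0"
    by (rule tendsto_sandwich[OF _ _ tendsto_const bound])
       (use ev * in \<open>auto elim: eventually_mono\<close>)
  have "(\<lambda>M. (?r M)\<^sup>2) \<longlonglongrightarrow> 0"
    by (rule tendsto_sandwich[OF _ _ tendsto_const n])
       (use ev * in \<open>auto elim: eventually_mono\<close>)
  then have "?r \<longlonglongrightarrow> 0"
    by simp
  with n show ?thesis ..
qed

end
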